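(* Let $Q(x)=1+\sum_{i\geq1}a_ix^i$ be a formal power series with rational coefficients and set $Q_t(x):=1+\sum_{i\geq1}(ta_i)x^i$. Define rational numbers $b^{(k)}_\lambda(Q)$ by $$e_k\big(Q(x_1)-1,Q(x_2)-1,\ldots\big)=\sum_{\lambda}b^{(k)}_{\lambda}(Q)\, e_{\lambda}(\mathbf{x}),\qquad k\geq1,$$ in the ring of symmetric formal power series in $\mathbf{x}=(x_1,x_2,\ldots)$. Then for each integer partition $\lambda=(\lambda_1,\ldots,\lambda_{l(\lambda)})=(1^{m_1(\lambda)}2^{m_2(\lambda)}\cdots)$, $$\sum_{k\geq1}b^{(k)}_{\lambda}(Q)\, t^k=\frac{(-1)^{|\lambda|-l(\lambda)}}{\prod_{i\geq1}m_i(\lambda)!}\sum_{\pi\in\Pi_{l(\lambda)}}\bigg\{\Big[\prod_{i=1}^{l(\pi)}(|\pi_i|-1)!\Big]\Big[\prod_{i=1}^{l(\pi)}\Big(\frac{1}{2\pi\sqrt{-1}}\oint\frac{Q'_t(x)}{x^{\lambda_{\pi_i}}Q_t(x)}dx\Big)\Big]\bigg\},$$ where $\frac{1}{2\pi\sqrt{-1}}\oint\frac{Q'_t(x)}{x^{m}Q_t(x)}dx$ denotes the coefficient of $x^{m-1}$ in the formal power series $Q_t'(x)/Q_t(x)$.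
   Context: $e_k(\mathbf{x})=\sum_{i_1<\cdots<i_k}x_{i_1}\cdots x_{i_k}$ is the $k$-th elementary symmetric function and $e_\lambda:=\prod_{i=1}^{l(\lambda)}e_{\lambda_i}$. For a partition $\lambda$: $l(\lambda)$ length, $|\lambda|$ weight, $m_i(\lambda)$ the number of parts equal to $i$. $\Pi_n$ is the set of set partitions of $\{1,\ldots,n\}$; for $\pi=\{\pi_1,\ldots,\pi_{l(\pi)}\}\in\Pi_{l(\lambda)}$, $l(\pi)$ is its number of blocks, $|\pi_i|$ block size, $\lambda_{\pi_i}:=\sum_{j\in\pi_i}\lambda_j$. *)

theory Defs
  imports "HOL-Computational_Algebra.Formal_Power_Series" "HOL-Library.Disjoint_Sets"
begin

text \<open>Formal power series over the rationals in the variables x_0, x_1, x_2, ...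
  A monomial is an exponent function alpha :: nat => nat (finite support);
  a series is its coefficient function.  We only ever evaluate series at
  monomials involving the first N variables.\<close>

type_synonym mvps = "(nat \<Rightarrow> nat) \<Rightarrow> rat"

definition mv_one :: mvps where
  "mv_one \<alpha> = (if (\<forall>i. \<alpha> i = 0) then 1 else 0)"

definition mv_minus :: "mvps \<Rightarrow> mvps \<Rightarrow> mvps" where
  "mv_minus f g = (\<lambda>\<alpha>. f \<alpha> - g \<alpha>)"

definition mv_mult :: "mvps \<Rightarrow> mvps \<Rightarrow> mvps" where
  "mv_mult f g \<alpha> = (\<Sum>\<beta>\<in>{\<beta>. \<forall>i. \<beta> i \<le> \<alpha> i}. f \<beta> * g (\<lambda>i. \<alpha> i - \<beta> i))"

definition mv_prod_list :: "mvps list \<Rightarrow> mvps" where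
  "mv_prod_list fs = foldr mv_mult fs mv_one"

definition mv_var :: "nat \<Rightarrow> mvps" where
  "mv_var i \<alpha> = (if \<alpha> = (\<lambda>j. if j = i then 1 else 0) then 1 else 0)"

definition mv_univ :: "rat fps \<Rightarrow> nat \<Rightarrow> mvps" where
  "mv_univ Q i \<alpha> = (if (\<forall>j. j \<noteq> i \<longrightarrow> \<alpha> j = 0) then fps_nth Q (\<alpha> i) else 0)"

definition esym :: "mvps list \<Rightarrow> nat \<Rightarrow> mvps" where
  "esym ys k = (\<lambda>\<alpha>. \<Sum>S\<in>{S. S \<subseteq> {..<length ys} \<and> card S = k}.
                   mv_prod_list (map (\<lambda>i. ys ! i) (sorted_list_of_set S)) \<alpha>)"

definition xvars :: "nat \<Rightarrow> mvps list" where
  "xvars N = map mv_var [0..<N]"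

definition elam :: "nat \<Rightarrow> nat list \<Rightarrow> mvps" where
  "elam N lam = mv_prod_list (map (esym (xvars N)) lam)"

definition is_partition :: "nat list \<Rightarrow> bool" where
  "is_partition lam \<longleftrightarrow> sorted_wrt (\<ge>) lam \<and> (\<forall>p\<in>set lam. 0 < p)"

text \<open>Q_t(x) = 1 + sum_i (t a_i) x^i, as a power series in x whose coefficients are
  power series (in fact polynomials) in t; t is the inner fps_X.\<close>
definition Qt :: "rat fps \<Rightarrow> rat fps fps" where
  "Qt Q = Abs_fps (\<lambda>i. if i = 0 then 1 else fps_const (fps_nth Q i) * fps_X)"

text \<open>(1/(2 pi i)) contour integral of Q_t'(x) / (x^m Q_t(x)) dx, i.e. the coefficient of
  x^(m-1) in Q_t'/Q_t, as a series in t.\<close>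
definition resQ :: "rat fps \<Rightarrow> nat \<Rightarrow> rat fps" where
  "resQ Q m = fps_nth (fps_deriv (Qt Q) * inverse (Qt Q)) (m - 1)"

end

theory Submission
  imports Defs "HOL-Combinatorics.Multiset_Permutations" "HOL-Combinatorics.List_Permutation"
begin

text \<open>
  The coefficient of a monomial with exponents \<open>\<alpha>\<close> in \<open>\<Prod>\<^sub>i Q\<^sub>t(x\<^sub>i)\<close> is the product of the coefficients of
  \<open>Q\<^sub>t\<close> at the \<open>\<alpha>\<^sub>i\<close>, that is, the image of \<open>e\<^sub>\<alpha>\<close> under the specialisation of symmetric functions
  sending \<open>e\<^sub>n\<close> to the \<open>n\<close>-th coefficient of \<open>Q\<^sub>t\<close>.  The expansion of \<open>e\<^sub>\<alpha>\<close> in monomial symmetric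
  functions \<open>m\<^sub>\<mu>\<close> has as coefficients the numbers of zero-one matrices with margins \<open>\<mu>\<close> and \<open>\<alpha>\<close>,
  which are also the coefficients of \<open>x\<^sup>\<alpha>\<close> in \<open>e\<^sub>\<mu>\<close>.  By linear independence of the \<open>e\<^sub>\<mu>\<close>, the series
  \<open>\<Sum>\<^sub>k b k \<mu> t\<^sup>k\<close> is therefore the specialisation of \<open>m\<^sub>\<mu>\<close>.  Moebius inversion on the partition lattice
  writes \<open>m\<^sub>\<mu>\<close> in power sums, and by Newton's identities \<open>p\<^sub>n\<close> specialises to
  \<open>(-1)\<^sup>n\<^sup>-\<^sup>1\<close> times the coefficient of \<open>x\<^sup>n\<^sup>-\<^sup>1\<close> in \<open>Q\<^sub>t'/Q\<^sub>t\<close>.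
\<close>

subsection \<open>Augmented monomial symmetric functions\<close>

lemma partition_on_extend_block:
  assumes "partition_on I P" "i \<notin> I" "B \<in> P"
  shows "partition_on (insert i I) (insert (insert i B) (P - {B}))"
proof -
  have U: "\<Union>P = I" and D: "\<And>X Y. X \<in> P \<Longrightarrow> Y \<in> P \<Longrightarrow> X \<noteq> Y \<Longrightarrow> X \<inter> Y = {}" and N: "{} \<notin> P"
    using assms by (auto simp: partition_on_def disjoint_def)
  show ?thesis
    unfolding partition_on_def disjoint_def
  proof (intro conjI ballI impI)
    show "\<Union>(insert (insert i B) (P - {B})) = insert i I"
      using U assms(3) by auto
    show "X \<inter> Y = {}" if "X \<in> insert (insert i B) (P - {B})" "Y \<in> insert (insert i B) (P - {B})"
      "X \<noteq> Y" for X Y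
      using that D[of X Y] D[of X B] D[of B Y] assms(2,3) U by auto
    show "{} \<notin> insert (insert i B) (P - {B})" using N by auto
  qed
qed

lemma partition_on_extend_singleton:
  assumes "partition_on I P" "i \<notin> I"
  shows "partition_on (insert i I) (insert {i} P)"
proof -
  have U: "\<Union>P = I" and D: "\<And>X Y. X \<in> P \<Longrightarrow> Y \<in> P \<Longrightarrow> X \<noteq> Y \<Longrightarrow> X \<inter> Y = {}" and N: "{} \<notin> P"
    using assms by (auto simp: partition_on_def disjoint_def)
  show ?thesis
    unfolding partition_on_def disjoint_def
  proof (intro conjI ballI impI)
    show "X \<inter> Y = {}" if "X \<in> insert {i} P" "Y \<in> insert {i} P" "X \<noteq> Y" for X Y
      using that D[of X Y] assms(2) U by auto
  qed (use U N in auto)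
qed

text \<open>The block containing \<open>i\<close> decides the case: it is \<open>{i}\<close>, or it
  stays nonempty when \<open>i\<close> is removed.\<close>

lemma partition_on_insert_cases:
  assumes Q: "partition_on (insert i I) Q" and i: "i \<notin> I"
  obtains P where "partition_on I P" "Q = insert {i} P"
  | P B where "partition_on I P" "B \<in> P" "Q = insert (insert i B) (P - {B})"
proof -
  have U: "\<Union>Q = insert i I" and D: "\<And>X Y. X \<in> Q \<Longrightarrow> Y \<in> Q \<Longrightarrow> X \<noteq> Y \<Longrightarrow> X \<inter> Y = {}" and N: "{} \<notin> Q"
    using assms by (auto simp: partition_on_def disjoint_def)
  obtain C where C: "C \<in> Q" "i \<in> C" using U by auto
  have iC: "i \<notin> X" if "X \<in> Q" "X \<noteq> C" for X using D[of X C] that C by auto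
  have UC: "\<Union>(Q - {C}) = I - C"
  proof (intro equalityI subsetI)
    fix x assume "x \<in> \<Union>(Q - {C})"
    then obtain X where X: "X \<in> Q" "X \<noteq> C" "x \<in> X" by auto
    then have "x \<noteq> i" "x \<notin> C" using iC[of X] D[of X C] C by auto
    with X U show "x \<in> I - C" by auto
  next
    fix x assume "x \<in> I - C"
    then show "x \<in> \<Union>(Q - {C})" using U by blast
  qed
  have CI: "C - {i} \<subseteq> I" using U C by auto
  show thesis
  proof (cases "C = {i}")
    case True
    have "partition_on I (Q - {C})"
      unfolding partition_on_def disjoint_def
      using UC N D i True by auto
    moreover have "Q = insert {i} (Q - {C})" using C True by auto
    ultimately show thesis by (rule that(1))
  next
    case False
    \<comment> \<open>A block \<open>C - {i}\<close> of \<open>Q\<close> would meet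
      \<open>C\<close>. Its absence makes inserting and then deleting \<open>C - {i}\<close>
      harmless.\<close>
    have notin: "C - {i} \<notin> Q"
      using D[of "C - {i}" C] C N False by auto
    have "partition_on I (insert (C - {i}) (Q - {C}))"
      unfolding partition_on_def disjoint_def
    proof (intro conjI ballI impI)
      show "\<Union>(insert (C - {i}) (Q - {C})) = I" using UC CI i C by auto
      show "X \<inter> Y = {}" if "X \<in> insert (C - {i}) (Q - {C})" "Y \<in> insert (C - {i}) (Q - {C})"
        "X \<noteq> Y" for X Y
        using that(1)
      proof
        assume X: "X = C - {i}"
        then have Y: "Y \<in> Q" "Y \<noteq> C" using that by auto
        with D[of C Y] C X show ?thesis by auto
      next
        assume X: "X \<in> Q - {C}"
        show ?thesis using that(2)
        proof
          assume "Y = C - {i}"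
          with D[of X C] C X show ?thesis by auto
        next
          assume "Y \<in> Q - {C}"
          with D[of X Y] X that show ?thesis by auto
        qed
      qed
      show "{} \<notin> insert (C - {i}) (Q - {C})" using N False C by auto
    qed
    moreover have "Q = insert (insert i (C - {i})) (insert (C - {i}) (Q - {C}) - {C - {i}})"
      using C notin by (simp add: insert_absorb)
    ultimately show thesis by (rule that(2)[OF _ insertI1])
  qed
qed

text \<open>Each partition of the larger set arises exactly once, by adding the block
  \<open>{i}\<close> or by putting \<open>i\<close> into a chosen block. This drives
  \<open>augmented_monomial_insert\<close>.\<close>

lemma sum_partitions_insert:
  fixes f :: "'a set set \<Rightarrow> 'b::comm_monoid_add"
  assumes "finite I" "i \<notin> I"
  shows "(\<Sum>Q | partition_on (insert i I) Q. f Q)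
    = (\<Sum>P | partition_on I P. f (insert {i} P) + (\<Sum>B\<in>P. f (insert (insert i B) (P - {B}))))"
proof -
  let ?\<P> = "{P. partition_on I P}"
  let ?S = "Sigma ?\<P> (\<lambda>P. P)"
  let ?g = "\<lambda>(P, B). insert (insert i B) (P - {B})"
  have fin: "finite ?\<P>" using assms(1) by (rule finitely_many_partition_on)
  have finS: "finite ?S"
    using fin finite_elements[OF assms(1)] by (intro finite_SigmaI) auto
  have eq: "{Q. partition_on (insert i I) Q} = insert {i} ` ?\<P> \<union> ?g ` ?S"
  proof (intro equalityI subsetI)
    fix Q assume "Q \<in> {Q. partition_on (insert i I) Q}"
    then have "partition_on (insert i I) Q" by simp
    then show "Q \<in> insert {i} ` ?\<P> \<union> ?g ` ?S"
      using assms(2)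
    proof (cases rule: partition_on_insert_cases)
      case (2 P B)
      then have "(P, B) \<in> ?S" "Q = ?g (P, B)" by auto
      then show ?thesis by blast
    qed auto
  next
    fix Q assume "Q \<in> insert {i} ` ?\<P> \<union> ?g ` ?S"
    then show "Q \<in> {Q. partition_on (insert i I) Q}"
      using assms(2) by (auto intro: partition_on_extend_singleton partition_on_extend_block)
  qed
  have sing: "{i} \<notin> P" "i \<notin> B" if "partition_on I P" "B \<in> P" for P B
    using that assms(2) by (auto simp: partition_on_def)
  have inj1: "inj_on (insert {i}) ?\<P>"
  proof (rule inj_onI)
    fix P P' assume *: "P \<in> ?\<P>" "P' \<in> ?\<P>" "insert {i} P = insert {i} P'"
    then have "{i} \<notin> P" "{i} \<notin> P'" using assms(2) by (auto simp: partition_on_def)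
    with *(3) show "P = P'" by (simp add: insert_ident)
  qed
  \<comment> \<open>The only block of the image that contains \<open>i\<close> is
    \<open>insert i B\<close>; it determines \<open>B\<close>, and then \<open>P\<close>.\<close>
  have inj2: "inj_on ?g ?S"
  proof (rule inj_onI)
    fix x y assume x: "x \<in> ?S" and y: "y \<in> ?S" and g: "?g x = ?g y"
    obtain P B P' B' where xy: "x = (P, B)" "y = (P', B')" by (cases x, cases y)
    have PB: "partition_on I P" "B \<in> P" "partition_on I P'" "B' \<in> P'" using x y xy by auto
    have g': "insert (insert i B) (P - {B}) = insert (insert i B') (P' - {B'})"
      using g xy by simp
    have n: "i \<notin> X" if "X \<in> P \<or> X \<in> P'" for X using sing(2) PB that by blast
    have "insert i B \<in> insert (insert i B') (P' - {B'})" using g' by blast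
    then have "insert i B = insert i B'" using n by blast
    then have B: "B = B'" using n PB by (auto simp: insert_ident)
    have "P - {B} = P' - {B'}"
    proof -
      have "insert i B \<notin> P - {B}" "insert i B' \<notin> P' - {B'}" using n by blast+
      with g' B show ?thesis by (simp add: insert_ident)
    qed
    then show "x = y" using B PB xy by blast
  qed
  have disj: "insert {i} ` ?\<P> \<inter> ?g ` ?S = {}"
  proof (rule equals0I)
    fix Q assume "Q \<in> insert {i} ` ?\<P> \<inter> ?g ` ?S"
    then obtain P P' B where *: "partition_on I P'" "B \<in> P'"
      "insert {i} P = insert (insert i B) (P' - {B})" by auto
    then have "{i} \<in> insert (insert i B) (P' - {B})" by blast
    then have "{i} = insert i B" using sing *(1,2) by blast
    then have "B = {}" using sing *(1,2) by blast
    then show False using *(1,2) by (auto simp: partition_on_def)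
  qed
  have "(\<Sum>Q | partition_on (insert i I) Q. f Q)
    = (\<Sum>Q\<in>insert {i} ` ?\<P>. f Q) + (\<Sum>Q\<in>?g ` ?S. f Q)"
    unfolding eq using fin finS disj by (intro sum.union_disjoint) auto
  also have "\<dots> = (\<Sum>P\<in>?\<P>. f (insert {i} P)) + (\<Sum>x\<in>?S. f (?g x))"
    using inj1 inj2 by (simp add: sum.reindex)
  also have "(\<Sum>x\<in>?S. f (?g x)) = (\<Sum>P\<in>?\<P>. \<Sum>B\<in>P. f (insert (insert i B) (P - {B})))"
    using fin finite_elements[OF assms(1)]
    by (subst sum.Sigma) (auto simp: case_prod_unfold)
  finally show ?thesis by (simp add: sum.distrib)
qed

text \<open>If \<open>p n = (\<Sum>v. y v ^ n)\<close>, this is the sum of \<open>\<Prod>i\<in>I. y (f i) ^ c i\<close> over all injections \<open>f\<close> of \<open>I\<close>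
  into the set of variables; the coefficients are the Moebius function of the partition lattice.\<close>
definition augmented_monomial :: "(nat \<Rightarrow> 'a::{comm_ring_1,semiring_char_0}) \<Rightarrow> 'i set \<Rightarrow> ('i \<Rightarrow> nat) \<Rightarrow> 'a" where
  "augmented_monomial p I c =
    (\<Sum>P | partition_on I P. \<Prod>B\<in>P. (-1) ^ (card B - 1) * fact (card B - 1) * p (\<Sum>i\<in>B. c i))"

lemma augmented_monomial_empty [simp]: "augmented_monomial p {} c = 1"
  by (simp add: augmented_monomial_def partition_on_empty)

lemma augmented_monomial_cong:
  assumes "\<And>i. i \<in> I \<Longrightarrow> c i = d i"
  shows "augmented_monomial p I c = augmented_monomial p I d"
proof -
  have "(\<Sum>i\<in>B. c i) = (\<Sum>i\<in>B. d i)" if "partition_on I P" "B \<in> P" for P B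
    using that assms by (intro sum.cong) (auto simp: partition_on_def)
  then show ?thesis
    unfolding augmented_monomial_def by (intro sum.cong prod.cong) auto
qed

text \<open>For actual power sums: choose a value for \<open>i\<close> freely, then remove the
  collisions with some \<open>j\<close>, where the exponents add up. For arbitrary \<open>p\<close>
  it holds because the weight of a block of size \<open>m + 1\<close> is \<open>- m\<close> times
  that of size \<open>m\<close>.\<close>

lemma augmented_monomial_insert:
  fixes p :: "nat \<Rightarrow> 'a::{comm_ring_1,semiring_char_0}" and I :: "'i set"
  assumes fin: "finite I" and i: "i \<notin> I"
  shows "augmented_monomial p (insert i I) c
    = p (c i) * augmented_monomial p I c
      - (\<Sum>j\<in>I. augmented_monomial p I (c(j := c j + c i)))"
proof -
  let ?w = "\<lambda>n. (-1) ^ (n - 1) * fact (n - 1) :: 'a"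
  let ?h = "\<lambda>c B. ?w (card B) * p (\<Sum>i\<in>B. c i)"
  have block: "finite B" "B \<noteq> {}" "i \<notin> B" "B \<subseteq> I" if "partition_on I P" "B \<in> P" for P B
    using that fin i by (auto simp: partition_on_def intro: finite_subset)
  have finP: "finite P" if "partition_on I P" for P
    using that fin finite_elements by blast
  have single: "(\<Prod>B\<in>insert {i} P. ?h c B) = p (c i) * (\<Prod>B\<in>P. ?h c B)"
    if "partition_on I P" for P
  proof -
    have "{i} \<notin> P" using that i by (auto simp: partition_on_def)
    then show ?thesis using finP[OF that] by (simp add: prod.insert)
  qed
  \<comment> \<open>The factor \<open>- card B\<close> gained by the weight is spread over the
    elements \<open>j\<close> of \<open>B\<close>: raising the exponent at any one of them affects
    only the factor of \<open>B\<close>, and always by \<open>c i\<close>.\<close>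
  have merge: "(\<Prod>C\<in>insert (insert i B) (P - {B}). ?h c C)
      = - (\<Sum>j\<in>B. \<Prod>C\<in>P. ?h (c(j := c j + c i)) C)"
    if P: "partition_on I P" and B: "B \<in> P" for P B
  proof -
    have nin: "insert i B \<notin> P - {B}" using block(3)[OF P] by blast
    have cB: "card B > 0" using block[OF P B] by (simp add: card_gt_0_iff)
    then obtain m where m: "card B = Suc m" by (cases "card B") auto
    have 1: "(\<Prod>C\<in>insert (insert i B) (P - {B}). ?h c C)
      = - of_nat (card B) * ?w (card B) * p (c i + sum c B) * (\<Prod>C\<in>P - {B}. ?h c C)"
    proof -
      have "?w (card (insert i B)) = - of_nat (card B) * ?w (card B)"
        using block[OF P B] by (simp add: m algebra_simps)
      moreover have "sum c (insert i B) = c i + sum c B" using block[OF P B] by simp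
      moreover have "(\<Prod>C\<in>insert (insert i B) (P - {B}). ?h c C)
          = ?h c (insert i B) * (\<Prod>C\<in>P - {B}. ?h c C)"
        using nin finP[OF P] by (intro prod.insert) auto
      ultimately show ?thesis by simp
    qed
    have 2: "(\<Prod>C\<in>P. ?h (c(j := c j + c i)) C)
      = ?w (card B) * p (c i + sum c B) * (\<Prod>C\<in>P - {B}. ?h c C)" if j: "j \<in> B" for j
    proof -
      have "sum (c(j := c j + c i)) B = c i + sum c B"
        using j block[OF P B] by (simp add: sum.remove[of B j])
      moreover have "?h (c(j := c j + c i)) C = ?h c C" if "C \<in> P - {B}" for C
      proof -
        have "j \<notin> C" using that j B P by (auto simp: partition_on_def disjoint_def)
        then have "sum (c(j := c j + c i)) C = sum c C" by (intro sum.cong) auto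
        then show ?thesis by simp
      qed
      moreover have "(\<Prod>C\<in>P. ?h (c(j := c j + c i)) C)
          = ?h (c(j := c j + c i)) B * (\<Prod>C\<in>P - {B}. ?h (c(j := c j + c i)) C)"
        using finP[OF P] B by (intro prod.remove) auto
      ultimately show ?thesis by simp
    qed
    have "(\<Sum>j\<in>B. \<Prod>C\<in>P. ?h (c(j := c j + c i)) C)
        = of_nat (card B) * (?w (card B) * p (c i + sum c B) * (\<Prod>C\<in>P - {B}. ?h c C))"
      using 2 by simp
    then show ?thesis unfolding 1 by (simp only: mult.assoc mult_minus_left)
  qed
  have blocks: "(\<Sum>B\<in>P. \<Sum>j\<in>B. f j) = (\<Sum>j\<in>I. f j)" if "partition_on I P" for P and f :: "'i \<Rightarrow> 'a"
  proof -
    have "I = \<Union>P" using that by (simp add: partition_on_def)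
    then show ?thesis
      using that block[OF that] unfolding partition_on_def disjoint_def
      by (subst sum.Union_disjoint[symmetric, of P f, unfolded o_def]) auto
  qed
  have "augmented_monomial p (insert i I) c
    = (\<Sum>P | partition_on I P. p (c i) * (\<Prod>B\<in>P. ?h c B)
        + (\<Sum>B\<in>P. - (\<Sum>j\<in>B. \<Prod>C\<in>P. ?h (c(j := c j + c i)) C)))"
    unfolding augmented_monomial_def sum_partitions_insert[OF fin i]
    using single merge by (intro sum.cong) auto
  also have "\<dots> = (\<Sum>P | partition_on I P. p (c i) * (\<Prod>B\<in>P. ?h c B)
        - (\<Sum>j\<in>I. \<Prod>C\<in>P. ?h (c(j := c j + c i)) C))"
    by (intro sum.cong) (simp_all add: sum_negf blocks)
  also have "\<dots> = p (c i) * augmented_monomial p I c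
      - (\<Sum>j\<in>I. augmented_monomial p I (c(j := c j + c i)))"
    unfolding augmented_monomial_def sum_subtractf sum_distrib_left
    by (subst sum.swap[of _ I]) simp
  finally show ?thesis .
qed

text \<open>Induction through \<open>augmented_monomial_insert\<close> avoids transporting set
  partitions along \<open>f\<close>; \<open>c\<close> stays arbitrary because merging changes the
  exponents.\<close>

lemma augmented_monomial_image:
  assumes "finite I" "inj_on f I"
  shows "augmented_monomial p (f ` I) c = augmented_monomial p I (c \<circ> f)"
  using assms
proof (induction I arbitrary: c rule: finite_induct)
  case (insert i I)
  have IH: "augmented_monomial p (f ` I) (c(f j := c (f j) + c (f i)))
      = augmented_monomial p I ((c \<circ> f)(j := (c \<circ> f) j + (c \<circ> f) i))" if "j \<in> I" for j
  proof -
    have "augmented_monomial p (f ` I) (c(f j := c (f j) + c (f i)))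
      = augmented_monomial p I (c(f j := c (f j) + c (f i)) \<circ> f)"
      using insert.prems by (intro insert.IH) auto
    also have "\<dots> = augmented_monomial p I ((c \<circ> f)(j := (c \<circ> f) j + (c \<circ> f) i))"
      using insert.prems that by (intro augmented_monomial_cong) (auto simp: inj_on_def)
    finally show ?thesis .
  qed
  have "f i \<notin> f ` I" "inj_on f I" using insert.prems insert.hyps by auto
  then have "augmented_monomial p (f ` insert i I) c
    = p (c (f i)) * augmented_monomial p (f ` I) c
      - (\<Sum>j\<in>I. augmented_monomial p (f ` I) (c(f j := c (f j) + c (f i))))"
    using insert.hyps by (simp add: augmented_monomial_insert sum.reindex)
  also have "\<dots> = augmented_monomial p (insert i I) (c \<circ> f)"
    unfolding augmented_monomial_insert[OF insert.hyps]
    using insert.IH[OF \<open>inj_on f I\<close>] IH by (intro arg_cong2[where f = "(-)"] sum.cong) (auto simp: comp_def)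
  finally show ?case .
qed simp

subsection \<open>Newton identities and the Pieri rule\<close>

text \<open>The exponents of \<open>I\<close> together with \<open>k\<close> extra exponents 1. The
  disjoint sum supplies fresh indices for them whatever the type of \<open>I\<close>.\<close>

definition augmented_ones :: "(nat \<Rightarrow> 'a::{comm_ring_1,semiring_char_0}) \<Rightarrow> 'i set \<Rightarrow> ('i \<Rightarrow> nat) \<Rightarrow> nat \<Rightarrow> 'a" where
  "augmented_ones p I c k = augmented_monomial p (I <+> {..<k}) (case_sum c (\<lambda>_. 1))"

text \<open>Invariance under reindexing brings any index set that splits into a copy of
  \<open>I\<close> and \<open>k\<close> places of exponent 1 into this normal form.\<close>

lemma augmented_monomial_eq_ones:
  assumes "finite I" "finite J" "card J = k" "inj_on f I" "f ` I \<inter> J = {}"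
    and "\<And>i. i \<in> I \<Longrightarrow> d (f i) = c i" "\<And>j. j \<in> J \<Longrightarrow> d j = 1"
  shows "augmented_monomial p (f ` I \<union> J) d = augmented_ones p I c k"
proof -
  obtain g where g: "bij_betw g {..<k} J"
    using bij_betw_iff_card[of "{..<k}" J] assms by auto
  let ?f = "case_sum f g"
  have gJ: "g ` {..<k} = J" and ginj: "inj_on g {..<k}" using g by (auto simp: bij_betw_def)
  have im: "?f ` (I <+> {..<k}) = f ` I \<union> J"
    using gJ by (auto simp: Plus_def image_Un image_image)
  have "inj_on ?f (I <+> {..<k})"
  proof (rule inj_onI)
    fix x y assume *: "x \<in> I <+> {..<k}" "y \<in> I <+> {..<k}" "?f x = ?f y"
    have ne: "f i \<noteq> g l" if "i \<in> I" "l < k" for i l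
      using assms(5) gJ that by (metis IntI emptyE imageI lessThan_iff)
    from * show "x = y"
      using inj_onD[OF assms(4)] inj_onD[OF ginj] ne ne[symmetric]
      by (elim PlusE) auto
  qed
  then have "augmented_monomial p (f ` I \<union> J) d = augmented_monomial p (I <+> {..<k}) (d \<circ> ?f)"
    unfolding im[symmetric] using assms(1) by (intro augmented_monomial_image) auto
  also have "\<dots> = augmented_ones p I c k"
    unfolding augmented_ones_def
    using assms(6,7) gJ by (intro augmented_monomial_cong) auto
  finally show ?thesis .
qed

lemma augmented_ones_0:
  assumes "finite I"
  shows "augmented_ones p I c 0 = augmented_monomial p I c"
  using augmented_monomial_eq_ones[of I "{}" 0 id c c p] assms by simp

lemma augmented_ones_cong:
  "(\<And>i. i \<in> I \<Longrightarrow> c i = d i) \<Longrightarrow> augmented_ones p I c k = augmented_ones p I d k"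
  unfolding augmented_ones_def by (intro augmented_monomial_cong) auto

text \<open>Collisions of \<open>i\<close> with each of the \<open>k\<close> extra parts give the
  same term, in which \<open>c i\<close> is raised by 1 and one extra part is used up. For
  \<open>k = 0\<close> the factor \<open>of_nat k\<close> removes the term with the truncated
  \<open>k - 1\<close>.\<close>

lemma augmented_ones_insert:
  fixes c :: "'b \<Rightarrow> nat"
  assumes I: "finite I" "i \<notin> I"
  shows "augmented_ones p (insert i I) c k
    = p (c i) * augmented_ones p I c k
      - (\<Sum>j\<in>I. augmented_ones p I (c(j := c j + c i)) k)
      - of_nat k * augmented_ones p (insert i I) (c(i := c i + 1)) (k - 1)"
proof -
  let ?K = "I <+> {..<k}" and ?c = "case_sum c (\<lambda>_. 1)"
  have K: "insert i I <+> {..<k} = insert (Inl i) ?K" "finite ?K" "Inl i \<notin> ?K"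
    using I by auto
  have merge: "augmented_monomial p ?K (?c(Inr l := ?c (Inr l) + c i))
      = augmented_ones p (insert i I) (c(i := c i + 1)) (k - 1)" if l: "l < k" for l
  proof -
    \<comment> \<open>After the merge, position \<open>Inr l\<close> carries the exponent
      \<open>c i + 1\<close> and so takes the role of \<open>i\<close>.\<close>
    let ?f = "\<lambda>j. if j = i then Inr l else Inl j"
    have "?K = ?f ` insert i I \<union> Inr ` ({..<k} - {l})"
    proof (intro equalityI subsetI)
      fix x assume "x \<in> ?f ` insert i I \<union> Inr ` ({..<k} - {l})"
      then show "x \<in> ?K" using l by auto
    next
      fix x assume "x \<in> ?K"
      then show "x \<in> ?f ` insert i I \<union> Inr ` ({..<k} - {l})"
      proof (elim PlusE)
        fix j assume "j \<in> I" "x = Inl j"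
        then have "x = ?f j" "j \<in> insert i I" using I by auto
        then show ?thesis by blast
      next
        fix m assume m: "m \<in> {..<k}" "x = Inr m"
        show ?thesis
        proof (cases "m = l")
          case True
          then have "x = ?f i" using m by simp
          then show ?thesis by blast
        qed (use m in auto)
      qed
    qed
    moreover have "augmented_monomial p (?f ` insert i I \<union> Inr ` ({..<k} - {l})) (?c(Inr l := ?c (Inr l) + c i))
        = augmented_ones p (insert i I) (c(i := c i + 1)) (k - 1)"
    proof (rule augmented_monomial_eq_ones)
      show "inj_on ?f (insert i I)" by (auto simp: inj_on_def split: if_splits)
      show "card (Inr ` ({..<k} - {l}) :: ('b + nat) set) = k - 1" using l by (simp add: card_image)
      show "?f ` insert i I \<inter> Inr ` ({..<k} - {l}) = {}" by (auto split: if_splits)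
    qed (use I l in \<open>auto split: if_splits\<close>)
    ultimately show ?thesis by simp
  qed
  have "(\<Sum>j\<in>?K. augmented_monomial p ?K (?c(j := ?c j + c i)))
    = (\<Sum>j\<in>I. augmented_monomial p ?K (?c(Inl j := c j + c i)))
      + (\<Sum>l<k. augmented_monomial p ?K (?c(Inr l := ?c (Inr l) + c i)))"
    using I by (simp add: sum.Plus)
  also have "(\<Sum>j\<in>I. augmented_monomial p ?K (?c(Inl j := c j + c i)))
      = (\<Sum>j\<in>I. augmented_ones p I (c(j := c j + c i)) k)"
    unfolding augmented_ones_def
    by (intro sum.cong augmented_monomial_cong) (auto split: sum.splits)
  also have "(\<Sum>l<k. augmented_monomial p ?K (?c(Inr l := ?c (Inr l) + c i)))
      = of_nat k * augmented_ones p (insert i I) (c(i := c i + 1)) (k - 1)"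
    using merge by simp
  finally have merged: "(\<Sum>j\<in>?K. augmented_monomial p ?K (?c(j := ?c j + c i)))
    = (\<Sum>j\<in>I. augmented_ones p I (c(j := c j + c i)) k)
      + of_nat k * augmented_ones p (insert i I) (c(i := c i + 1)) (k - 1)" .
  have "augmented_ones p (insert i I) c k = p (c i) * augmented_ones p I c k
      - (\<Sum>j\<in>?K. augmented_monomial p ?K (?c(j := ?c j + c i)))"
    unfolding augmented_ones_def K(1) augmented_monomial_insert[OF K(2,3)] by simp
  then show ?thesis unfolding merged by (simp only: diff_diff_eq)
qed

text \<open>Here \<open>h k\<close> plays the role of \<open>1 / k!\<close>, so that no division is needed.\<close>
locale newton_sequence =
  fixes p E h :: "nat \<Rightarrow> 'a::{idom,semiring_char_0}"
  assumes E_0: "E 0 = 1"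
    and newton: "of_nat (Suc k) * E (Suc k) = (\<Sum>i\<le>k. (-1) ^ i * p (Suc i) * E (k - i))"
    and h_0: "h 0 = 1"
    and h_Suc: "of_nat (Suc k) * h (Suc k) = h k"
begin

text \<open>The \<open>k\<close> extra parts are interchangeable; \<open>h k\<close> removes the
  resulting multiplicity \<open>fact k\<close>.\<close>

definition divided_ones :: "'i set \<Rightarrow> ('i \<Rightarrow> nat) \<Rightarrow> nat \<Rightarrow> 'a" where
  "divided_ones I c k = augmented_ones p I c k * h k"

lemma divided_ones_insert:
  assumes "finite I" "i \<notin> I"
  shows "divided_ones (insert i I) c k
    = p (c i) * divided_ones I c k
      - (\<Sum>j\<in>I. divided_ones I (c(j := c j + c i)) k)
      - (if k = 0 then 0 else divided_ones (insert i I) (c(i := c i + 1)) (k - 1))"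
proof (cases k)
  case (Suc m)
  have "divided_ones (insert i I) (c(i := c i + 1)) m
      = of_nat k * augmented_ones p (insert i I) (c(i := c i + 1)) m * h k"
    unfolding divided_ones_def Suc h_Suc[of m, symmetric] by (simp only: ac_simps)
  moreover have "divided_ones (insert i I) c k = p (c i) * divided_ones I c k
      - (\<Sum>j\<in>I. divided_ones I (c(j := c j + c i)) k)
      - of_nat k * augmented_ones p (insert i I) (c(i := c i + 1)) m * h k"
    unfolding divided_ones_def augmented_ones_insert[OF assms, of p c k]
    by (simp only: Suc diff_Suc_1 left_diff_distrib sum_distrib_right mult.assoc)
  ultimately show ?thesis by (simp add: Suc)
qed (simp add: divided_ones_def augmented_ones_insert[OF assms, of p c 0] left_diff_distrib sum_distrib_right mult.assoc)

text \<open>The monomial symmetric function of \<open>k\<close> ones is the elementary one: both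
  satisfy Newton's recurrence, whose leading factor \<open>of_nat (Suc k)\<close> can be
  cancelled.\<close>

lemma divided_ones_empty: "divided_ones {} c k = E k"
proof -
  let ?U = "\<lambda>k. divided_ones ({} :: unit set) (\<lambda>_. 0) k"
  \<comment> \<open>Each use of the insertion rule splits off the power sum of the single part and
    raises that part by 1 with a change of sign; unrolled, this is the alternating sum.\<close>
  have single: "divided_ones {()} (\<lambda>_. n) k = (\<Sum>i\<le>k. (-1) ^ i * p (n + i) * ?U (k - i))" for n k
  proof (induction k arbitrary: n)
    case 0
    have "divided_ones {()} (\<lambda>_. n) 0 = p n * divided_ones {} (\<lambda>_::unit. n) 0"
      by (subst divided_ones_insert) auto
    then show ?case by (simp add: divided_ones_def augmented_ones_0)
  next
    case (Suc k)
    have "(\<lambda>_. n)(() := n + 1) = (\<lambda>_. Suc n)" by auto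
    then have "divided_ones {()} (\<lambda>_. n) (Suc k)
        = p n * divided_ones {} (\<lambda>_::unit. n) (Suc k) - divided_ones {()} (\<lambda>_. Suc n) k"
      by (subst divided_ones_insert) auto
    also have "divided_ones {} (\<lambda>_::unit. n) (Suc k) = ?U (Suc k)"
      unfolding divided_ones_def by (subst augmented_ones_cong[of "{}" _ "\<lambda>_. 0"]) auto
    finally show ?case
      unfolding Suc.IH sum.atMost_Suc_shift by (simp add: sum_negf)
  qed
  \<comment> \<open>One of the \<open>Suc k\<close> equal parts, the one at index \<open>k\<close>,
    is singled out, which replaces \<open>h (Suc k)\<close> by \<open>h k\<close>.\<close>
  have step: "of_nat (Suc k) * ?U (Suc k) = divided_ones {()} (\<lambda>_. 1) k" for k
  proof -
    let ?K = "({} :: unit set) <+> {..<Suc k}"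
    have "?K = (\<lambda>_. Inr k) ` {()} \<union> Inr ` {..<k}"
      by auto
    then have "augmented_monomial p ?K (case_sum (\<lambda>_. 0) (\<lambda>_. 1)) = augmented_ones p {()} (\<lambda>_. 1) k"
      by (simp only:) (rule augmented_monomial_eq_ones; auto simp: card_image)
    then show ?thesis
      unfolding divided_ones_def h_Suc[of k, symmetric] augmented_ones_def[of p "{}"]
      by (simp only: ac_simps)
  qed
  have "?U k = E k"
  proof (induction k rule: less_induct)
    case (less k)
    show ?case
    proof (cases k)
      case 0
      then show ?thesis by (simp add: divided_ones_def augmented_ones_0 E_0 h_0)
    next
      case (Suc m)
      have "of_nat (Suc m) * ?U (Suc m) = (\<Sum>i\<le>m. (-1) ^ i * p (Suc i) * ?U (m - i))"
        unfolding step single by simp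
      also have "\<dots> = of_nat (Suc m) * E (Suc m)"
        unfolding newton using less Suc by (intro sum.cong) auto
      finally show ?thesis
        unfolding Suc by (metis mult_cancel_left of_nat_neq_0)
    qed
  qed
  \<comment> \<open>The recurrence was run over the index type \<open>unit\<close>; only the
    \<open>k\<close> ones are present, so the value carries over to every type.\<close>
  moreover have "divided_ones {} c k = ?U k"
  proof -
    have "({} :: 'b set) <+> {..<k} = Inr ` {..<k}" "({} :: unit set) <+> {..<k} = Inr ` {..<k}"
      by auto
    then show ?thesis
      unfolding divided_ones_def augmented_ones_def
      by (simp add: augmented_monomial_image comp_def)
  qed
  ultimately show ?thesis by simp
qed

text \<open>In the induction, the term produced by merging the new part with one of the extra parts 1
  cancels the summand in which the new part itself is raised.\<close>
lemma pieri_rule: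
  assumes "finite I"
  shows "(\<Sum>S\<in>Pow I. if card S \<le> r
      then divided_ones I (\<lambda>i. c i + of_bool (i \<in> S)) (r - card S) else 0)
    = E r * augmented_monomial p I c"
  using assms
proof (induction I arbitrary: c rule: finite_induct)
  case empty
  then show ?case by (simp add: divided_ones_empty)
next
  case (insert i I)
  let ?t = "\<lambda>I c S. if card S \<le> r
      then divided_ones I (\<lambda>i. c i + of_bool (i \<in> S)) (r - card S) else 0"
  have pair: "?t (insert i I) c S + ?t (insert i I) c (insert i S)
      = p (c i) * ?t I c S - (\<Sum>j\<in>I. ?t I (c(j := c j + c i)) S)" if S: "S \<subseteq> I" for S
  proof -
    have fin: "finite S" and i: "i \<notin> S" using S insert.hyps by (auto intro: finite_subset)
    let ?c = "\<lambda>c i. c i + of_bool (i \<in> S) :: nat"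
    have upd: "(?c c)(j := ?c c j + ?c c i) = ?c (c(j := c j + c i))" for j
      using i by (auto simp: fun_eq_iff)
    have updi: "(?c c)(i := ?c c i + 1) = (\<lambda>j. c j + of_bool (j \<in> insert i S))"
      using i by (auto simp: fun_eq_iff)
    have rec: "divided_ones (insert i I) (?c c) k
      = p (c i) * divided_ones I (?c c) k - (\<Sum>j\<in>I. divided_ones I (?c (c(j := c j + c i))) k)
        - (if k = 0 then 0 else divided_ones (insert i I) (\<lambda>j. c j + of_bool (j \<in> insert i S)) (k - 1))" for k
    proof -
      have ci: "?c c i = c i" using i by simp
      show ?thesis
        unfolding divided_ones_insert[OF insert.hyps(1,2), of "?c c" k] upd updi unfolding ci ..
    qed
    show ?thesis
    proof (cases "card S \<le> r")
      case True
      have ins: "card (insert i S) = Suc (card S)" using fin i by simp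
      \<comment> \<open>For \<open>card S = r\<close> the set \<open>insert i S\<close> is too
        large, which matches the absent last term of \<open>divided_ones_insert\<close> at
        \<open>k = 0\<close>.\<close>
      have "?t (insert i I) c (insert i S) = (if r - card S = 0 then 0
         else divided_ones (insert i I) (\<lambda>j. c j + of_bool (j \<in> insert i S)) (r - card S - 1))"
        using True unfolding ins by (cases "r = card S") simp_all
      with True rec[of "r - card S"] show ?thesis by simp
    qed (use fin i in simp)
  qed
  have "(\<Sum>S\<in>Pow (insert i I). ?t (insert i I) c S)
    = (\<Sum>S\<in>Pow I. ?t (insert i I) c S + ?t (insert i I) c (insert i S))"
  proof -
    have "inj_on (insert i) (Pow I)" "Pow I \<inter> insert i ` Pow I = {}"
      using insert.hyps by (auto simp: inj_on_def insert_ident)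
    then show ?thesis
      unfolding Pow_insert sum.distrib
      using insert.hyps by (subst sum.union_disjoint) (simp_all add: sum.reindex)
  qed
  also have "\<dots> = (\<Sum>S\<in>Pow I. p (c i) * ?t I c S - (\<Sum>j\<in>I. ?t I (c(j := c j + c i)) S))"
    using pair by (intro sum.cong) auto
  also have "\<dots> = p (c i) * (\<Sum>S\<in>Pow I. ?t I c S) - (\<Sum>j\<in>I. \<Sum>S\<in>Pow I. ?t I (c(j := c j + c i)) S)"
    unfolding sum_subtractf sum_distrib_left by (subst sum.swap[of _ I]) simp
  also have "\<dots> = E r * augmented_monomial p (insert i I) c"
    unfolding insert.IH augmented_monomial_insert[OF insert.hyps(1,2)]
    by (simp only: right_diff_distrib sum_distrib_left mult.left_commute)
  finally show ?case .
qed

end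

subsection \<open>Zero-one matrices with prescribed margins\<close>

text \<open>A zero-one matrix is stored as the relation of the positions of its ones, so that
  transposing is taking the converse.\<close>

definition margin_matrices :: "'i set \<Rightarrow> 'j set \<Rightarrow> ('i \<Rightarrow> nat) \<Rightarrow> ('j \<Rightarrow> nat) \<Rightarrow> ('i \<times> 'j) set set" where
  "margin_matrices I J \<mu> \<alpha> = {R. R \<subseteq> I \<times> J \<and> (\<forall>i\<in>I. card (R `` {i}) = \<mu> i)
      \<and> (\<forall>j\<in>J. card (R\<inverse> `` {j}) = \<alpha> j)}"

lemma finite_margin_matrices:
  assumes "finite I" "finite J"
  shows "finite (margin_matrices I J \<mu> \<alpha>)"
proof (rule finite_subset)
  show "margin_matrices I J \<mu> \<alpha> \<subseteq> Pow (I \<times> J)" by (auto simp: margin_matrices_def)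
qed (use assms in auto)

lemma margin_matrices_empty:
  "margin_matrices {} J \<mu> \<alpha> = (if \<forall>j\<in>J. \<alpha> j = 0 then {{}} else {})"
  by (auto simp: margin_matrices_def)

lemma margin_matrices_cong:
  assumes "\<And>i. i \<in> I \<Longrightarrow> \<mu> i = \<mu>' i" "\<And>j. j \<in> J \<Longrightarrow> \<alpha> j = \<alpha>' j"
  shows "margin_matrices I J \<mu> \<alpha> = margin_matrices I J \<mu>' \<alpha>'"
  using assms by (simp add: margin_matrices_def)

lemma card_margin_matrices_transpose:
  "card (margin_matrices I J \<mu> \<alpha>) = card (margin_matrices J I \<alpha> \<mu>)"
proof (rule bij_betw_same_card)
  show "bij_betw converse (margin_matrices I J \<mu> \<alpha>) (margin_matrices J I \<alpha> \<mu>)"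
    by (rule bij_betw_byWitness[where f' = converse]) (auto simp: margin_matrices_def)
qed

text \<open>Cutting off row \<open>i\<close>, whose ones stand in the columns \<open>S\<close>,
  lowers the sums of these columns by 1. The condition \<open>1 \<le> \<alpha> j\<close> keeps the
  subtraction from truncating.\<close>

lemma card_margin_matrices_insert_row:
  assumes fin: "finite I" "finite J" and i: "i \<notin> I"
  shows "card (margin_matrices (insert i I) J \<mu> \<alpha>)
    = (\<Sum>S | S \<subseteq> J \<and> card S = \<mu> i \<and> (\<forall>j\<in>S. 1 \<le> \<alpha> j).
        card (margin_matrices I J \<mu> (\<lambda>j. \<alpha> j - of_bool (j \<in> S))))"
proof -
  let ?S = "{S. S \<subseteq> J \<and> card S = \<mu> i \<and> (\<forall>j\<in>S. 1 \<le> \<alpha> j)}"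
  let ?M = "\<lambda>S. margin_matrices I J \<mu> (\<lambda>j. \<alpha> j - of_bool (j \<in> S))"
  let ?f = "\<lambda>(S, R). R \<union> {i} \<times> S" and ?g = "\<lambda>R. (R `` {i}, R \<inter> I \<times> J)"
  have finS: "finite ?S" by (rule finite_subset[of _ "Pow J"]) (use fin in auto)
  have "bij_betw ?f (Sigma ?S ?M) (margin_matrices (insert i I) J \<mu> \<alpha>)"
  proof (rule bij_betw_byWitness[where f' = ?g])
    show "\<forall>x\<in>Sigma ?S ?M. ?g (?f x) = x"
    proof
      fix x assume "x \<in> Sigma ?S ?M"
      then obtain S R where x: "x = (S, R)" "R \<in> ?M S" by blast
      then have "R \<subseteq> I \<times> J" by (simp add: margin_matrices_def)
      then have "(R \<union> {i} \<times> S) `` {i} = S" "(R \<union> {i} \<times> S) \<inter> I \<times> J = R"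
        using i by blast+
      then show "?g (?f x) = x" by (simp add: x)
    qed
    show "\<forall>R\<in>margin_matrices (insert i I) J \<mu> \<alpha>. ?f (?g R) = R"
    proof
      fix R assume "R \<in> margin_matrices (insert i I) J \<mu> \<alpha>"
      then have "R \<subseteq> insert i I \<times> J" by (simp add: margin_matrices_def)
      then have "R \<inter> I \<times> J \<union> {i} \<times> R `` {i} = R" by blast
      then show "?f (?g R) = R" by simp
    qed
    show "?f ` Sigma ?S ?M \<subseteq> margin_matrices (insert i I) J \<mu> \<alpha>"
    proof clarsimp
      fix S R assume S: "S \<subseteq> J" "card S = \<mu> i" "\<forall>j\<in>S. Suc 0 \<le> \<alpha> j" and R: "R \<in> ?M S"
      have RIJ: "R \<subseteq> I \<times> J" and row: "\<And>k. k \<in> I \<Longrightarrow> card (R `` {k}) = \<mu> k"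
        and col: "\<And>j. j \<in> J \<Longrightarrow> card (R\<inverse> `` {j}) = \<alpha> j - of_bool (j \<in> S)"
        using R by (auto simp: margin_matrices_def)
      show "R \<union> {i} \<times> S \<in> margin_matrices (insert i I) J \<mu> \<alpha>"
        unfolding margin_matrices_def
      proof (intro CollectI conjI ballI)
        show "R \<union> {i} \<times> S \<subseteq> insert i I \<times> J" using RIJ S by auto
        show "card ((R \<union> {i} \<times> S) `` {k}) = \<mu> k" if k: "k \<in> insert i I" for k
        proof (cases "k = i")
          case True
          then have "(R \<union> {i} \<times> S) `` {k} = S" using RIJ i by auto
          then show ?thesis using True S by simp
        next
          case False
          then have "(R \<union> {i} \<times> S) `` {k} = R `` {k}" by auto
          then show ?thesis using row False k by simp
        qed
        show "card ((R \<union> {i} \<times> S)\<inverse> `` {j}) = \<alpha> j" if j: "j \<in> J" for j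
        proof (cases "j \<in> S")
          case True
          then have "(R \<union> {i} \<times> S)\<inverse> `` {j} = insert i (R\<inverse> `` {j})" by auto
          moreover have "i \<notin> R\<inverse> `` {j}" using RIJ i by auto
          moreover have "finite (R\<inverse> `` {j})" by (rule finite_subset[of _ I]) (use RIJ fin in auto)
          ultimately have "card ((R \<union> {i} \<times> S)\<inverse> `` {j}) = Suc (\<alpha> j - 1)"
            using col[OF j] True by simp
          also have "\<dots> = \<alpha> j" using S(3) True by auto
          finally show ?thesis .
        next
          case False
          then have "(R \<union> {i} \<times> S)\<inverse> `` {j} = R\<inverse> `` {j}" by auto
          then show ?thesis using col[OF j] False by simp
        qed
      qed
    qed
    show "?g ` margin_matrices (insert i I) J \<mu> \<alpha> \<subseteq> Sigma ?S ?M"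
    proof (intro image_subsetI)
      fix R assume R: "R \<in> margin_matrices (insert i I) J \<mu> \<alpha>"
      have RIJ: "R \<subseteq> insert i I \<times> J" and row: "\<And>k. k \<in> insert i I \<Longrightarrow> card (R `` {k}) = \<mu> k"
        and col: "\<And>j. j \<in> J \<Longrightarrow> card (R\<inverse> `` {j}) = \<alpha> j"
        using R by (auto simp: margin_matrices_def)
      have finc: "finite (R\<inverse> `` {j})" for j
        by (rule finite_subset[of _ "insert i I"]) (use RIJ fin in auto)
      have "R `` {i} \<in> ?S"
      proof (intro CollectI conjI ballI)
        show "R `` {i} \<subseteq> J" using RIJ by auto
        show "card (R `` {i}) = \<mu> i" using row by simp
        fix j assume j: "j \<in> R `` {i}"
        then have "j \<in> J" "R\<inverse> `` {j} \<noteq> {}" using RIJ by auto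
        then show "1 \<le> \<alpha> j" using col[of j] finc[of j] by (metis One_nat_def Suc_leI card_gt_0_iff)
      qed
      moreover have "R \<inter> I \<times> J \<in> ?M (R `` {i})"
        unfolding margin_matrices_def
      proof (intro CollectI conjI ballI)
        show "card ((R \<inter> I \<times> J) `` {k}) = \<mu> k" if k: "k \<in> I" for k
        proof -
          have "(R \<inter> I \<times> J) `` {k} = R `` {k}" using RIJ k by auto
          then show ?thesis using row k by simp
        qed
        show "card ((R \<inter> I \<times> J)\<inverse> `` {j}) = \<alpha> j - of_bool (j \<in> R `` {i})" if j: "j \<in> J" for j
        proof -
          have "(R \<inter> I \<times> J)\<inverse> `` {j} = R\<inverse> `` {j} - {i}" using RIJ i j by auto
          then show ?thesis using col[OF j] finc[of j] by (auto simp: card_Diff_singleton_if)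
        qed
      qed auto
      ultimately show "?g R \<in> Sigma ?S ?M" by simp
    qed
  qed
  then have "card (margin_matrices (insert i I) J \<mu> \<alpha>) = card (Sigma ?S ?M)"
    by (rule bij_betw_same_card[symmetric])
  also have "\<dots> = (\<Sum>S\<in>?S. card (?M S))"
    using finS fin by (simp add: finite_margin_matrices)
  finally show ?thesis .
qed

lemma card_margin_matrices_insert_column:
  assumes "finite I" "finite J" "j \<notin> J"
  shows "card (margin_matrices I (insert j J) \<mu> \<alpha>)
    = (\<Sum>S | S \<subseteq> I \<and> card S = \<alpha> j \<and> (\<forall>i\<in>S. 1 \<le> \<mu> i).
        card (margin_matrices I J (\<lambda>i. \<mu> i - of_bool (i \<in> S)) \<alpha>))"
  using card_margin_matrices_insert_row[OF assms(2,1,3), of \<alpha> \<mu>]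
  by (simp add: card_margin_matrices_transpose[of I])

lemma card_margin_matrices_zero_row:
  assumes "finite I" "finite J" "i \<notin> I" "\<mu> i = 0"
  shows "card (margin_matrices (insert i I) J \<mu> \<alpha>) = card (margin_matrices I J \<mu> \<alpha>)"
proof -
  have "{S. S \<subseteq> J \<and> card S = \<mu> i \<and> (\<forall>j\<in>S. 1 \<le> \<alpha> j)} = {{}}"
    using assms finite_subset[OF _ assms(2)] by auto
  then show ?thesis using assms by (simp add: card_margin_matrices_insert_row)
qed

lemma card_margin_matrices_support:
  assumes "finite K" "finite J"
  shows "card (margin_matrices K J \<mu> \<alpha>) = card (margin_matrices {i \<in> K. \<mu> i \<noteq> 0} J \<mu> \<alpha>)"
  using assms(1)
proof (induction K arbitrary: \<alpha> rule: finite_induct)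
  case (insert i K)
  show ?case
  proof (cases "\<mu> i = 0")
    case True
    then have "{j \<in> insert i K. \<mu> j \<noteq> 0} = {j \<in> K. \<mu> j \<noteq> 0}" by auto
    then show ?thesis
      using insert True assms(2) by (simp add: card_margin_matrices_zero_row)
  next
    case False
    then have "{j \<in> insert i K. \<mu> j \<noteq> 0} = insert i {j \<in> K. \<mu> j \<noteq> 0}" by auto
    then show ?thesis
      using insert assms(2) by (simp add: card_margin_matrices_insert_row)
  qed
qed simp

lemma card_margin_matrices_image:
  assumes "finite I" "finite J" "inj_on f I"
  shows "card (margin_matrices (f ` I) J \<mu> \<alpha>) = card (margin_matrices I J (\<mu> \<circ> f) \<alpha>)"
  using assms(1,3)
proof (induction I arbitrary: \<alpha> rule: finite_induct)
  case empty
  then show ?case by (simp add: margin_matrices_empty)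
next
  case (insert i I)
  then have "f i \<notin> f ` I" "inj_on f I" by auto
  then show ?case
    using insert assms(2) by (simp add: card_margin_matrices_insert_row)
qed

subsection \<open>The dual Cauchy expansion\<close>

text \<open>Values from \<open>M\<close> on are fixed to 0, so each vector of \<open>M\<close>
  entries is represented by one function and the set is finite.\<close>

definition weak_compositions :: "nat \<Rightarrow> nat \<Rightarrow> (nat \<Rightarrow> nat) set" where
  "weak_compositions M n = {c. (\<forall>i\<ge>M. c i = 0) \<and> (\<Sum>i<M. c i) = n}"

lemma finite_weak_compositions: "finite (weak_compositions M n)"
proof (rule finite_subset)
  show "weak_compositions M n \<subseteq> {c. \<forall>i. (i \<in> {..<M} \<longrightarrow> c i \<in> {..n}) \<and> (i \<notin> {..<M} \<longrightarrow> c i = 0)}"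
    by (auto simp: weak_compositions_def intro: member_le_sum[where f = c for c])
  show "finite {c. \<forall>i. (i \<in> {..<M} \<longrightarrow> c i \<in> {..n}) \<and> (i \<notin> {..<M} \<longrightarrow> c i = (0::nat))}"
    by (intro finite_set_of_finite_funs) auto
qed

lemma card_support_le_sum:
  assumes "finite A"
  shows "card {i \<in> A. c i \<noteq> (0::nat)} \<le> sum c A"
proof -
  have "card {i \<in> A. c i \<noteq> 0} = (\<Sum>i\<in>{i \<in> A. c i \<noteq> 0}. 1)" by simp
  also have "\<dots> \<le> (\<Sum>i\<in>{i \<in> A. c i \<noteq> 0}. c i)" by (intro sum_mono) auto
  also have "\<dots> \<le> sum c A" using assms by (intro sum_mono2) auto
  finally show ?thesis .
qed

text \<open>A subset of \<open>K\<close> is split into its part in \<open>I\<close> and the rest.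
  Without the test \<open>card S \<le> r\<close>, truncation of \<open>r - card S\<close> to 0 would
  admit \<open>T = {}\<close>.\<close>

lemma sum_split_subsets:
  fixes g :: "'a set \<Rightarrow> 'b::comm_monoid_add"
  assumes "finite K" "I \<subseteq> K"
  shows "(\<Sum>S | S \<subseteq> K \<and> card S = r. g S)
    = (\<Sum>S\<in>Pow I. if card S \<le> r then \<Sum>T | T \<subseteq> K - I \<and> card T = r - card S. g (S \<union> T) else 0)"
proof -
  have fin: "finite I" using assms by (rule finite_subset[rotated])
  let ?B = "\<lambda>S. {T. T \<subseteq> K - I \<and> card T = r - card S}"
  have cU: "card (S \<union> T) = card S + card T" if "S \<subseteq> I" "T \<subseteq> K - I" for S T
    using that assms fin by (intro card_Un_disjoint) (auto dest: finite_subset)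
  have "(\<Sum>S\<in>Pow I. if card S \<le> r then \<Sum>T\<in>?B S. g (S \<union> T) else 0)
    = (\<Sum>S\<in>{S \<in> Pow I. card S \<le> r}. \<Sum>T\<in>?B S. g (S \<union> T))"
    using fin by (subst sum.inter_filter) auto
  also have "\<dots> = (\<Sum>(S, T)\<in>Sigma {S \<in> Pow I. card S \<le> r} ?B. g (S \<union> T))"
  proof (rule sum.Sigma)
    show "\<forall>S\<in>{S \<in> Pow I. card S \<le> r}. finite (?B S)"
      using assms by simp
  qed (use fin in simp)
  also have "\<dots> = (\<Sum>S | S \<subseteq> K \<and> card S = r. g S)"
  proof (rule sum.reindex_bij_witness[where j = "\<lambda>(S, T). S \<union> T" and i = "\<lambda>S. (S \<inter> I, S - I)"])
    fix S assume S: "S \<in> {S. S \<subseteq> K \<and> card S = r}"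
    then have "card (S \<inter> I) + card (S - I) = r"
      using cU[of "S \<inter> I" "S - I"] by (simp add: Int_Diff_Un Diff_mono)
    with S show "(S \<inter> I, S - I) \<in> Sigma {S \<in> Pow I. card S \<le> r} ?B" by auto
  next
    fix x assume x: "x \<in> Sigma {S \<in> Pow I. card S \<le> r} ?B"
    then obtain S T where "x = (S, T)" "S \<subseteq> I" "card S \<le> r" "T \<subseteq> K - I" "card T = r - card S"
      by auto
    then show "(case x of (S, T) \<Rightarrow> S \<union> T) \<in> {S. S \<subseteq> K \<and> card S = r}"
      using cU[of S T] assms by auto
  qed auto
  finally show ?thesis ..
qed

section \<open>Pieri rule and dual Cauchy expansion for padded exponent vectors\<close>

context newton_sequence
begin

lemma fact_h: "fact k * h k = 1"
proof (induction k)
  case (Suc k)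
  have "fact (Suc k) * h (Suc k) = fact k * (of_nat (Suc k) * h (Suc k))"
    by (simp only: fact_Suc ac_simps)
  then show ?case unfolding h_Suc Suc.IH .
qed (simp add: h_0)

lemma binomial_h:
  assumes "k \<le> m"
  shows "of_nat (m choose k) * fact (m - k) = fact m * h k"
proof -
  have "fact m * h k = of_nat (m choose k) * fact (m - k) * (fact k * h k)"
    using arg_cong[OF binomial_fact_lemma[OF assms], of "of_nat :: nat \<Rightarrow> 'a"]
    by (simp add: ac_simps)
  then show ?thesis by (simp add: fact_h)
qed

text \<open>Padding the exponent vector with zeros to a fixed length \<open>M\<close> removes the bookkeeping of parts that
  vanish when a column of a zero-one matrix is deleted; the factor \<open>(M - l)! / M!\<close> makes the
  sum over all arrangements of a partition with \<open>l\<close> parts independent of \<open>M\<close>.\<close>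
definition padded_monomial :: "nat \<Rightarrow> (nat \<Rightarrow> nat) \<Rightarrow> 'a" where
  "padded_monomial M c = (let I = {i \<in> {..<M}. c i \<noteq> 0} in
    augmented_monomial p I c * fact (M - card I) * h M)"

text \<open>The raised positions split into those in the support and new ones \<open>T\<close>
  outside. For a fixed first part all \<open>T\<close> contribute equally; their number
  \<open>(M - card I) choose k\<close> times the padding factor leaves
  \<open>fact (M - card I) * h k\<close>, and \<open>pieri_rule\<close> applies.\<close>

lemma padded_monomial_pieri:
  assumes c: "c \<in> weak_compositions M n" and r: "r + n \<le> M"
  shows "(\<Sum>S | S \<subseteq> {..<M} \<and> card S = r. padded_monomial M (\<lambda>i. c i + of_bool (i \<in> S)))
    = E r * padded_monomial M c"
proof -
  define I where "I = {i \<in> {..<M}. c i \<noteq> 0}"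
  have I: "I \<subseteq> {..<M}" "finite I" by (auto simp: I_def)
  \<comment> \<open>Nonzero entries are at least 1, so the support has at most \<open>n\<close>
    elements and \<open>r\<close> new positions fit beside it.\<close>
  have cI: "card I + r \<le> M"
    using card_support_le_sum[of "{..<M}" c] c r by (simp add: I_def weak_compositions_def)
  let ?g = "\<lambda>S. padded_monomial M (\<lambda>i. c i + of_bool (i \<in> S))"
  have inner: "(\<Sum>T | T \<subseteq> {..<M} - I \<and> card T = r - card S. ?g (S \<union> T))
      = divided_ones I (\<lambda>i. c i + of_bool (i \<in> S)) (r - card S) * (fact (M - card I) * h M)"
    if S: "S \<subseteq> I" "card S \<le> r" for S
  proof -
    let ?k = "r - card S" and ?c = "\<lambda>i. c i + of_bool (i \<in> S)"
    have summand: "?g (S \<union> T) = augmented_ones p I ?c ?k * fact (M - card I - ?k) * h M"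
      if T: "T \<subseteq> {..<M} - I" "card T = ?k" for T
    proof -
      have supp: "{i \<in> {..<M}. c i + of_bool (i \<in> S \<union> T) \<noteq> 0} = I \<union> T"
        using T S I by (auto simp: I_def)
      have finT: "finite T" using T by (auto dest: finite_subset)
      have "card (I \<union> T) = card I + ?k"
        using T I finT by (subst card_Un_disjoint) auto
      moreover have "augmented_monomial p (id ` I \<union> T) (\<lambda>i. c i + of_bool (i \<in> S \<union> T))
          = augmented_ones p I ?c ?k"
        using T S I finT by (intro augmented_monomial_eq_ones) (auto simp: I_def)
      ultimately show ?thesis
        unfolding padded_monomial_def Let_def supp by simp
    qed
    have "card {T. T \<subseteq> {..<M} - I \<and> card T = ?k} = (M - card I) choose ?k"
      using I by (subst n_subsets) (auto simp: card_Diff_subset)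
    then have "(\<Sum>T | T \<subseteq> {..<M} - I \<and> card T = ?k. ?g (S \<union> T))
      = of_nat ((M - card I) choose ?k) * fact (M - card I - ?k) * (augmented_ones p I ?c ?k * h M)"
      using summand by (simp add: ac_simps)
    also have "\<dots> = divided_ones I ?c ?k * (fact (M - card I) * h M)"
      using cI by (subst binomial_h) (auto simp: divided_ones_def ac_simps)
    finally show ?thesis .
  qed
  have "(\<Sum>S | S \<subseteq> {..<M} \<and> card S = r. ?g S)
    = (\<Sum>S\<in>Pow I. if card S \<le> r then divided_ones I (\<lambda>i. c i + of_bool (i \<in> S)) (r - card S)
         * (fact (M - card I) * h M) else 0)"
    unfolding sum_split_subsets[OF finite_lessThan I(1)]
  proof (rule sum.cong[OF refl])
    fix S assume "S \<in> Pow I"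
    then show "(if card S \<le> r then \<Sum>T | T \<subseteq> {..<M} - I \<and> card T = r - card S. ?g (S \<union> T) else 0)
      = (if card S \<le> r then divided_ones I (\<lambda>i. c i + of_bool (i \<in> S)) (r - card S)
         * (fact (M - card I) * h M) else 0)"
      by (cases "card S \<le> r") (simp_all only: inner Pow_iff if_True if_False)
  qed
  also have "\<dots> = (\<Sum>S\<in>Pow I. if card S \<le> r then divided_ones I (\<lambda>i. c i + of_bool (i \<in> S)) (r - card S) else 0)
         * (fact (M - card I) * h M)"
    unfolding sum_distrib_right by (intro sum.cong) auto
  also have "\<dots> = E r * padded_monomial M c"
    unfolding pieri_rule[OF I(2)] by (simp add: padded_monomial_def I_def Let_def ac_simps)
  finally show ?thesis .
qed

text \<open>Induction over the columns: removing column \<open>N\<close> with ones in the rows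
  \<open>S\<close> subtracts the indicator of \<open>S\<close> from \<open>c\<close>, and summing
  over \<open>S\<close> for a fixed remainder is the Pieri rule for
  \<open>E (\<alpha> N)\<close>.\<close>

lemma prod_E_eq_sum_weak_compositions:
  fixes N M :: nat and \<alpha> :: "nat \<Rightarrow> nat"
  assumes "(\<Sum>i<N. \<alpha> i) \<le> M"
  shows "(\<Prod>i<N. E (\<alpha> i)) = (\<Sum>c\<in>weak_compositions M (\<Sum>i<N. \<alpha> i).
    padded_monomial M c * of_nat (card (margin_matrices {..<M} {..<N} c \<alpha>)))"
  using assms
proof (induction N)
  case 0
  have "weak_compositions M 0 = {\<lambda>_. 0}"
    by (auto simp: weak_compositions_def fun_eq_iff) (metis lessThan_iff not_le)
  then show ?case
    by (simp add: padded_monomial_def fact_h card_margin_matrices_transpose[of "{..<M}"] margin_matrices_empty)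
next
  case (Suc N)
  let ?n = "\<Sum>i<N. \<alpha> i" and ?r = "\<alpha> N"
  let ?S = "{S. S \<subseteq> {..<M} \<and> card S = ?r}"
  let ?m = "\<lambda>c. of_nat (card (margin_matrices {..<M} {..<N} c \<alpha>)) :: 'a"
  have finS: "finite ?S" by simp
  have "(\<Sum>c\<in>weak_compositions M (?n + ?r).
      padded_monomial M c * of_nat (card (margin_matrices {..<M} {..<Suc N} c \<alpha>)))
    = (\<Sum>c\<in>weak_compositions M (?n + ?r). \<Sum>S\<in>{S \<in> ?S. \<forall>i\<in>S. 1 \<le> c i}.
        padded_monomial M c * ?m (\<lambda>i. c i - of_bool (i \<in> S)))"
    unfolding lessThan_Suc
    by (simp add: card_margin_matrices_insert_column sum_distrib_left conj_assoc)
  also have "\<dots> = (\<Sum>(c, S)\<in>(SIGMA c:weak_compositions M (?n + ?r). {S \<in> ?S. \<forall>i\<in>S. 1 \<le> c i}).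
        padded_monomial M c * ?m (\<lambda>i. c i - of_bool (i \<in> S)))"
    by (rule sum.Sigma) (auto simp: finite_weak_compositions)
  \<comment> \<open>The sum is reindexed by the remainder; \<open>1 \<le> c i\<close> on
    \<open>S\<close> makes subtracting and adding the indicator mutually inverse.\<close>
  also have "\<dots> = (\<Sum>(c, S)\<in>weak_compositions M ?n \<times> ?S.
        padded_monomial M (\<lambda>i. c i + of_bool (i \<in> S)) * ?m c)"
  proof (rule sum.reindex_bij_witness[where j = "\<lambda>(c, S). (\<lambda>i. c i - of_bool (i \<in> S), S)"
        and i = "\<lambda>(c, S). (\<lambda>i. c i + of_bool (i \<in> S), S)"])
    have sum_bool: "(\<Sum>i<M. of_bool (i \<in> S)) = card S" if "S \<subseteq> {..<M}" for S
      using that by (simp add: Int_absorb1)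
    fix x assume x: "x \<in> (SIGMA c:weak_compositions M (?n + ?r). {S \<in> ?S. \<forall>i\<in>S. 1 \<le> c i})"
    then obtain c S where cS: "x = (c, S)" "c \<in> weak_compositions M (?n + ?r)" "S \<in> ?S"
      "\<And>i. i \<in> S \<Longrightarrow> 1 \<le> c i" by auto
    have inv: "(\<lambda>i. c i - of_bool (i \<in> S) + of_bool (i \<in> S)) = c"
      using cS(4) by (force simp: fun_eq_iff)
    show "(case (case x of (c, S) \<Rightarrow> (\<lambda>i. c i - of_bool (i \<in> S), S)) of
        (c, S) \<Rightarrow> (\<lambda>i. c i + of_bool (i \<in> S), S)) = x"
      using cS(1) inv by simp
    have "(\<Sum>i<M. c i - of_bool (i \<in> S)) + card S = (\<Sum>i<M. c i)"
      using arg_cong[OF inv, of "\<lambda>c. \<Sum>i<M. c i"] sum_bool[of S] cS(3) by (simp add: sum.distrib)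
    then show "(case x of (c, S) \<Rightarrow> (\<lambda>i. c i - of_bool (i \<in> S), S)) \<in> weak_compositions M ?n \<times> ?S"
      using cS by (auto simp: weak_compositions_def)
    show "(case case x of (c, S) \<Rightarrow> (\<lambda>i. c i - of_bool (i \<in> S), S) of (c, S) \<Rightarrow>
        padded_monomial M (\<lambda>i. c i + of_bool (i \<in> S)) * ?m c)
      = (case x of (c, S) \<Rightarrow> padded_monomial M c * ?m (\<lambda>i. c i - of_bool (i \<in> S)))"
      using cS(1) inv by simp
  next
    have sum_bool: "(\<Sum>i<M. of_bool (i \<in> S)) = card S" if "S \<subseteq> {..<M}" for S
      using that by (simp add: Int_absorb1)
    fix y assume y: "y \<in> weak_compositions M ?n \<times> ?S"
    then obtain c S where cS: "y = (c, S)" "c \<in> weak_compositions M ?n" "S \<in> ?S" by auto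
    show "(case (case y of (c, S) \<Rightarrow> (\<lambda>i. c i + of_bool (i \<in> S), S)) of
        (c, S) \<Rightarrow> (\<lambda>i. c i - of_bool (i \<in> S), S)) = y"
      using cS by simp
    show "(case y of (c, S) \<Rightarrow> (\<lambda>i. c i + of_bool (i \<in> S), S))
        \<in> (SIGMA c:weak_compositions M (?n + ?r). {S \<in> ?S. \<forall>i\<in>S. 1 \<le> c i})"
      using cS sum_bool[of S] by (auto simp: weak_compositions_def sum.distrib)
  qed
  also have "\<dots> = (\<Sum>c\<in>weak_compositions M ?n.
      (\<Sum>S\<in>?S. padded_monomial M (\<lambda>i. c i + of_bool (i \<in> S))) * ?m c)"
    by (simp add: sum.cartesian_product[symmetric] sum_distrib_right)
  also have "\<dots> = (\<Sum>c\<in>weak_compositions M ?n. E ?r * (padded_monomial M c * ?m c))"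
    using Suc.prems by (intro sum.cong) (auto simp: padded_monomial_pieri mult.assoc)
  also have "\<dots> = (\<Prod>i<Suc N. E (\<alpha> i))"
    using Suc by (simp add: sum_distrib_left[symmetric] mult.commute)
  finally show ?case by simp
qed

end

section \<open>Partitions underlying weak compositions\<close>

lemma length_le_sum_list_partition:
  assumes "is_partition mu"
  shows "length mu \<le> sum_list mu"
proof -
  have "\<And>x. x \<in> set mu \<Longrightarrow> 0 < x" using assms by (simp add: is_partition_def)
  then show ?thesis by (induction mu) (auto simp: Suc_le_eq add_strict_increasing)
qed

lemma finite_partitions: "finite {mu. is_partition mu \<and> sum_list mu = n}"
proof (rule finite_subset)
  show "{mu. is_partition mu \<and> sum_list mu = n} \<subseteq> {xs. set xs \<subseteq> {..n} \<and> length xs \<le> n}"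
    using length_le_sum_list_partition by (auto intro: member_le_sum_list)
qed (simp add: finite_lists_length_le)

definition parts_of :: "nat \<Rightarrow> (nat \<Rightarrow> nat) \<Rightarrow> nat list" where
  "parts_of M c = rev (sort (filter (\<lambda>x. x \<noteq> 0) (map c [0..<M])))"

lemma is_partition_parts_of: "is_partition (parts_of M c)"
  by (auto simp: is_partition_def parts_of_def sorted_wrt_rev)

lemma sum_list_parts_of: "sum_list (parts_of M c) = (\<Sum>i<M. c i)"
proof -
  have drop_zeros: "sum_mset (filter_mset (\<lambda>x. x \<noteq> 0) A) = sum_mset A" for A :: "nat multiset"
    by (induction A) auto
  have "sum_list (parts_of M c) = sum_mset (filter_mset (\<lambda>x. x \<noteq> 0) (mset (map c [0..<M])))"
    unfolding parts_of_def sum_mset_sum_list[symmetric] by simp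
  also have "\<dots> = sum_list (map c [0..<M])"
    unfolding sum_mset_sum_list[symmetric] by (rule drop_zeros)
  also have "\<dots> = (\<Sum>i<M. c i)"
    by (simp add: sum_list_sum_nth lessThan_atLeast0)
  finally show ?thesis .
qed

lemma partition_eq_if_mset_eq:
  assumes "is_partition xs" "is_partition ys" "mset xs = mset ys"
  shows "xs = ys"
proof -
  have "sorted (rev xs)" "sorted (rev ys)"
    using assms(1,2) by (auto simp: is_partition_def sorted_wrt_rev)
  then have "rev xs = rev ys"
    using assms(3) by (metis mset_rev properties_for_sort)
  then show ?thesis by simp
qed

lemma parts_of_eq_iff:
  assumes "is_partition mu"
  shows "parts_of M c = mu \<longleftrightarrow>
    mset (map c [0..<M]) = mset mu + replicate_mset (M - length mu) 0 \<and> length mu \<le> M"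
proof
  assume mu: "parts_of M c = mu"
  let ?A = "mset (map c [0..<M])"
  have A: "mset mu = filter_mset (\<lambda>x. x \<noteq> 0) ?A"
    using mu by (auto simp: parts_of_def)
  have Z: "filter_mset (\<lambda>x. \<not> x \<noteq> 0) ?A = replicate_mset (count ?A 0) 0"
    by (simp only: not_not filter_eq_replicate_mset)
  have split: "?A = mset mu + replicate_mset (count ?A 0) 0"
    unfolding A Z[symmetric] by (rule multiset_partition)
  then have "size ?A = length mu + count ?A 0"
    by (metis size_union size_mset size_replicate_mset)
  then have "M = length mu + count ?A 0" by simp
  then show "?A = mset mu + replicate_mset (M - length mu) 0 \<and> length mu \<le> M"
    using split by (metis add_diff_cancel_left' le_add1)
next
  assume A: "mset (map c [0..<M]) = mset mu + replicate_mset (M - length mu) 0 \<and> length mu \<le> M"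
  have nz: "filter_mset (\<lambda>x. x \<noteq> 0) (mset mu) = mset mu"
    using assms unfolding is_partition_def filter_mset_eq_conv by auto
  have z: "filter_mset (\<lambda>x. x \<noteq> 0) (replicate_mset k (0::nat)) = {#}" for k
    by (simp add: filter_mset_eq_conv)
  have "mset (parts_of M c) = filter_mset (\<lambda>x. x \<noteq> 0) (mset (map c [0..<M]))"
    by (simp add: parts_of_def)
  also have "\<dots> = mset mu"
    unfolding conjunct1[OF A] filter_union_mset nz z by simp
  finally have "mset (parts_of M c) = mset mu" .
  then show "parts_of M c = mu"
    by (rule partition_eq_if_mset_eq[OF is_partition_parts_of assms])
qed

text \<open>Sorting only permutes the nonzero entries; composed with the list of their positions,
  the permutation gives the reindexing needed for \<open>augmented_monomial\<close> and
  \<open>margin_matrices\<close>.\<close>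

lemma parts_of_bij:
  assumes "parts_of M c = mu"
  obtains f where "bij_betw f {..<length mu} {i \<in> {..<M}. c i \<noteq> 0}"
    "\<And>k. k < length mu \<Longrightarrow> mu ! k = c (f k)"
proof -
  let ?xs = "filter (\<lambda>i. c i \<noteq> 0) [0..<M]"
  have "mset mu = mset (map c ?xs)"
    using assms by (auto simp: parts_of_def filter_map comp_def)
  then obtain g where g: "bij_betw g {..<length mu} {..<length ?xs}"
    "\<And>k. k < length mu \<Longrightarrow> mu ! k = map c ?xs ! g k"
    using permutation_Ex_bij[of mu "map c ?xs"] by auto
  have "bij_betw ((!) ?xs) {..<length ?xs} {i \<in> {..<M}. c i \<noteq> 0}"
    by (rule bij_betw_nth) auto
  then have "bij_betw ((!) ?xs \<circ> g) {..<length mu} {i \<in> {..<M}. c i \<noteq> 0}"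
    by (rule bij_betw_trans[OF g(1)])
  moreover have "mu ! k = c (((!) ?xs \<circ> g) k)" if "k < length mu" for k
  proof -
    have "g k < length ?xs" using g(1) that by (auto simp: bij_betw_def)
    then show ?thesis using g(2)[OF that] by simp
  qed
  ultimately show thesis by (rule that)
qed

text \<open>The vectors with parts \<open>mu\<close> are the arrangements of \<open>mu\<close> and
  \<open>M - length mu\<close> zeros, counted by a multinomial coefficient. The product form
  transfers to rings without division.\<close>

lemma card_parts_of_fibre:
  assumes mu: "is_partition mu" "sum_list mu = n" "length mu \<le> M"
  shows "card {c \<in> weak_compositions M n. parts_of M c = mu}
      * ((\<Prod>i\<in>set mu. fact (count_list mu i)) * fact (M - length mu)) = fact M"
proof -
  let ?A = "mset mu + replicate_mset (M - length mu) 0"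
  have 0: "0 \<notin> set mu" using mu by (auto simp: is_partition_def)
  have "bij_betw (\<lambda>c. map c [0..<M]) {c \<in> weak_compositions M n. parts_of M c = mu} (permutations_of_multiset ?A)"
  proof (rule bij_betw_byWitness[where f' = "\<lambda>xs i. if i < M then xs ! i else 0"])
    show "\<forall>c\<in>{c \<in> weak_compositions M n. parts_of M c = mu}. (\<lambda>i. if i < M then map c [0..<M] ! i else 0) = c"
      by (auto simp: weak_compositions_def fun_eq_iff)
    have len: "length xs = M" if "xs \<in> permutations_of_multiset ?A" for xs
      using length_finite_permutations_of_multiset[OF that] mu(3) by simp
    have map: "map (\<lambda>i. if i < M then xs ! i else 0) [0..<M] = xs"
      if "xs \<in> permutations_of_multiset ?A" for xs
      using len[OF that] by (intro nth_equalityI) auto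
    then show "\<forall>xs\<in>permutations_of_multiset ?A. map (\<lambda>i. if i < M then xs ! i else 0) [0..<M] = xs"
      by blast
    show "(\<lambda>c. map c [0..<M]) ` {c \<in> weak_compositions M n. parts_of M c = mu} \<subseteq> permutations_of_multiset ?A"
      using parts_of_eq_iff[OF mu(1)] by (auto intro!: permutations_of_multisetI)
    show "(\<lambda>xs i. if i < M then xs ! i else 0) ` permutations_of_multiset ?A
        \<subseteq> {c \<in> weak_compositions M n. parts_of M c = mu}"
    proof (intro image_subsetI)
      fix xs assume xs: "xs \<in> permutations_of_multiset ?A"
      let ?c = "\<lambda>i. if i < M then xs ! i else 0"
      have "parts_of M ?c = mu"
        unfolding parts_of_eq_iff[OF mu(1)] map[OF xs]
        using permutations_of_multisetD[OF xs] mu(3) by simp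
      moreover from this have "(\<Sum>i<M. ?c i) = n"
        using sum_list_parts_of[of M ?c] mu(2) by simp
      ultimately show "?c \<in> {c \<in> weak_compositions M n. parts_of M c = mu}"
        by (simp add: weak_compositions_def)
    qed
  qed
  then have "card {c \<in> weak_compositions M n. parts_of M c = mu}
      = fact (size ?A) div (\<Prod>x\<in>set_mset ?A. fact (count ?A x))"
    by (simp only: bij_betw_same_card card_permutations_of_multiset)
  moreover have "(\<Prod>x\<in>set_mset ?A. fact (count ?A x) :: nat)
      = (\<Prod>x\<in>set mu. fact (count_list mu x)) * fact (M - length mu)"
  proof -
    have c0: "count (mset mu) 0 = 0" using 0 by (simp add: not_in_iff[symmetric])
    \<comment> \<open>The value 0 is included even if \<open>M = length mu\<close>; it then
      contributes \<open>fact 0 = 1\<close>.\<close>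
    have "(\<Prod>x\<in>set_mset ?A. fact (count ?A x) :: nat) = (\<Prod>x\<in>insert 0 (set mu). fact (count ?A x))"
      by (rule prod.mono_neutral_left) (auto simp: c0 not_in_iff split: if_splits)
    also have "\<dots> = fact (M - length mu) * (\<Prod>x\<in>set mu. fact (count ?A x))"
    proof -
      have "count ?A 0 = M - length mu" by (simp only: count_union count_replicate_mset c0) simp
      then show ?thesis by (simp only: prod.insert[OF finite_set 0])
    qed
    also have "(\<Prod>x\<in>set mu. fact (count ?A x) :: nat) = (\<Prod>x\<in>set mu. fact (count_list mu x))"
      using 0 by (intro prod.cong) (auto simp: count_mset)
    finally show ?thesis by (simp add: mult.commute)
  qed
  moreover have "(\<Prod>x\<in>set_mset ?A. fact (count ?A x)) dvd (fact (size ?A) :: nat)"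
    by (rule card_permutations_of_multiset(2))
  moreover have "size ?A = M" using mu(3) by simp
  ultimately show ?thesis by (metis dvd_div_mult_self)
qed

context newton_sequence
begin

text \<open>The value of the monomial symmetric function of \<open>mu\<close>: permuting equal parts
  does not change a monomial, and the factors \<open>h\<close> divide by the number of these
  permutations.\<close>

definition monomial_value :: "nat list \<Rightarrow> 'a" where
  "monomial_value mu = augmented_monomial p {..<length mu} ((!) mu) * (\<Prod>i\<in>set mu. h (count_list mu i))"

lemma padded_monomial_parts_of:
  assumes "parts_of M c = mu"
  shows "padded_monomial M c = augmented_monomial p {..<length mu} ((!) mu) * fact (M - length mu) * h M"
    and "finite J \<Longrightarrow> card (margin_matrices {..<M} J c \<alpha>) = card (margin_matrices {..<length mu} J ((!) mu) \<alpha>)"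
proof -
  obtain f where f: "bij_betw f {..<length mu} {i \<in> {..<M}. c i \<noteq> 0}"
    "\<And>k. k < length mu \<Longrightarrow> mu ! k = c (f k)"
    using parts_of_bij[OF assms] by blast
  have im: "{i \<in> {..<M}. c i \<noteq> 0} = f ` {..<length mu}" and inj: "inj_on f {..<length mu}"
    using f(1) by (auto simp: bij_betw_def)
  have "augmented_monomial p (f ` {..<length mu}) c = augmented_monomial p {..<length mu} ((!) mu)"
    unfolding augmented_monomial_image[OF finite_lessThan inj]
    using f(2) by (intro augmented_monomial_cong) auto
  then show "padded_monomial M c = augmented_monomial p {..<length mu} ((!) mu) * fact (M - length mu) * h M"
    unfolding padded_monomial_def im Let_def using inj by (simp add: card_image)
  assume J: "finite J"
  have "card (margin_matrices {..<M} J c \<alpha>) = card (margin_matrices (f ` {..<length mu}) J c \<alpha>)"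
    using J by (subst card_margin_matrices_support) (simp_all only: im finite_lessThan)
  also have "\<dots> = card (margin_matrices {..<length mu} J (c \<circ> f) \<alpha>)"
    using J inj by (intro card_margin_matrices_image) auto
  also have "margin_matrices {..<length mu} J (c \<circ> f) \<alpha> = margin_matrices {..<length mu} J ((!) mu) \<alpha>"
    using f(2) by (intro margin_matrices_cong) auto
  finally show "card (margin_matrices {..<M} J c \<alpha>) = card (margin_matrices {..<length mu} J ((!) mu) \<alpha>)" .
qed

text \<open>Weak compositions are grouped by their partitions. The size of a fibre times the padding
  factor is the product of the \<open>h (count_list mu i)\<close>, which turns the augmented
  monomial into \<open>monomial_value\<close>.\<close>

theorem prod_E_eq_sum_partitions:
  fixes \<alpha> :: "nat \<Rightarrow> nat" and N :: nat
  shows "(\<Prod>i<N. E (\<alpha> i)) = (\<Sum>mu | is_partition mu \<and> sum_list mu = (\<Sum>i<N. \<alpha> i).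
    monomial_value mu * of_nat (card (margin_matrices {..<length mu} {..<N} ((!) mu) \<alpha>)))"
proof -
  \<comment> \<open>With \<open>M\<close> the total degree, vectors of \<open>M\<close> entries have
    room for every partition of \<open>M\<close>.\<close>
  define M where "M = (\<Sum>i<N. \<alpha> i)"
  let ?C = "\<lambda>mu. {c \<in> weak_compositions M M. parts_of M c = mu}"
  let ?P = "{mu. is_partition mu \<and> sum_list mu = M}"
  let ?m = "\<lambda>mu. of_nat (card (margin_matrices {..<length mu} {..<N} ((!) mu) \<alpha>)) :: 'a"
  have fibre: "(\<Sum>c\<in>?C mu. padded_monomial M c * of_nat (card (margin_matrices {..<M} {..<N} c \<alpha>)))
      = monomial_value mu * ?m mu" if mu: "mu \<in> ?P" for mu
  proof -
    have len: "length mu \<le> M" using mu length_le_sum_list_partition by force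
    let ?F = "(\<Prod>i\<in>set mu. fact (count_list mu i)) :: 'a"
    let ?H = "(\<Prod>i\<in>set mu. h (count_list mu i))"
    have FH: "?F * ?H = 1" by (simp add: fact_h flip: prod.distrib)
    have "of_nat (card (?C mu)) * (?F * fact (M - length mu)) = fact M"
      using arg_cong[OF card_parts_of_fibre[of mu M M], of "of_nat :: nat \<Rightarrow> 'a"] mu len by simp
    then have "of_nat (card (?C mu)) * (fact (M - length mu) * h M) * (?F * ?H) = fact M * h M * ?H"
      by (simp add: ac_simps)
    then have count: "of_nat (card (?C mu)) * (fact (M - length mu) * h M) = ?H"
      unfolding FH fact_h by simp
    have "(\<Sum>c\<in>?C mu. padded_monomial M c * of_nat (card (margin_matrices {..<M} {..<N} c \<alpha>)))
      = (\<Sum>c\<in>?C mu. augmented_monomial p {..<length mu} ((!) mu) * fact (M - length mu) * h M * ?m mu)"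
    proof (rule sum.cong[OF refl])
      fix c assume "c \<in> ?C mu"
      then have "parts_of M c = mu" by simp
      from padded_monomial_parts_of(1)[OF this] padded_monomial_parts_of(2)[OF this finite_lessThan]
      show "padded_monomial M c * of_nat (card (margin_matrices {..<M} {..<N} c \<alpha>))
        = augmented_monomial p {..<length mu} ((!) mu) * fact (M - length mu) * h M * ?m mu"
        by (simp only:)
    qed
    also have "\<dots> = augmented_monomial p {..<length mu} ((!) mu)
        * (of_nat (card (?C mu)) * (fact (M - length mu) * h M)) * ?m mu"
      by (simp add: ac_simps)
    also have "\<dots> = monomial_value mu * ?m mu"
      unfolding count monomial_value_def ..
    finally show ?thesis .
  qed
  have "(\<Prod>i<N. E (\<alpha> i)) = (\<Sum>c\<in>weak_compositions M M.
      padded_monomial M c * of_nat (card (margin_matrices {..<M} {..<N} c \<alpha>)))"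
    using prod_E_eq_sum_weak_compositions[of \<alpha> N M] by (simp add: M_def)
  also have "\<dots> = (\<Sum>mu\<in>?P. \<Sum>c\<in>?C mu.
      padded_monomial M c * of_nat (card (margin_matrices {..<M} {..<N} c \<alpha>)))"
  proof (rule sum.group[symmetric])
    show "parts_of M ` weak_compositions M M \<subseteq> ?P"
      by (auto simp: is_partition_parts_of sum_list_parts_of weak_compositions_def)
  qed (simp_all add: finite_weak_compositions finite_partitions)
  also have "\<dots> = (\<Sum>mu\<in>?P. monomial_value mu * ?m mu)"
    by (intro sum.cong fibre) auto
  finally show ?thesis unfolding M_def .
qed

end

subsection \<open>Elementary symmetric functions as coefficient functions\<close>

text \<open>The convolution in \<open>mv_mult\<close> sums over this set, and a sum over an infinite
  set would default to 0.\<close>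

lemma finite_monomials_below:
  fixes \<alpha> :: "nat \<Rightarrow> nat"
  assumes "\<forall>i\<ge>N. \<alpha> i = 0"
  shows "finite {\<beta>. \<forall>i. \<beta> i \<le> \<alpha> i}"
proof (rule finite_subset)
  show "{\<beta>. \<forall>i. \<beta> i \<le> \<alpha> i}
      \<subseteq> {\<beta>. \<forall>i. (i \<in> {..<N} \<longrightarrow> \<beta> i \<in> {..Max (\<alpha> ` {..<N})}) \<and> (i \<notin> {..<N} \<longrightarrow> \<beta> i = 0)}"
  proof (intro subsetI CollectI allI conjI impI)
    fix \<beta> i assume \<beta>: "\<beta> \<in> {\<beta>. \<forall>i. \<beta> i \<le> \<alpha> i}"
    then have le: "\<beta> i \<le> \<alpha> i" by simp
    show "\<beta> i \<in> {..Max (\<alpha> ` {..<N})}" if "i \<in> {..<N}"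
      using le that by (auto intro: order_trans Max_ge)
    show "\<beta> i = 0" if "i \<notin> {..<N}" using le assms that by (metis le_zero_eq lessThan_iff not_le)
  qed
  show "finite {\<beta>. \<forall>i. (i \<in> {..<N} \<longrightarrow> \<beta> i \<in> {..Max (\<alpha> ` {..<N})}) \<and> (i \<notin> {..<N} \<longrightarrow> \<beta> i = (0::nat))}"
    by (intro finite_set_of_finite_funs) auto
qed

text \<open>The factors live in different variables, so in each convolution only one
  \<open>\<beta>\<close> survives: the one that takes the whole exponent of \<open>i\<close> and
  nothing else.\<close>

lemma mv_prod_list_univariate:
  assumes F: "\<And>i \<beta>. F i \<beta> = (if \<forall>j. j \<noteq> i \<longrightarrow> \<beta> j = 0 then g (\<beta> i) else 0)"
    and "distinct is" and \<alpha>: "\<forall>i\<ge>N. \<alpha> i = 0"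
  shows "mv_prod_list (map F is) \<alpha> = (if \<forall>j. j \<notin> set is \<longrightarrow> \<alpha> j = 0 then \<Prod>i\<in>set is. g (\<alpha> i) else 0)"
  using assms(2,3)
proof (induction "is" arbitrary: \<alpha>)
  case Nil
  then show ?case by (simp add: mv_prod_list_def mv_one_def)
next
  case (Cons i "is")
  let ?B = "{\<beta>. \<forall>j. \<beta> j \<le> \<alpha> j}" and ?\<beta> = "\<lambda>j. if j = i then \<alpha> i else 0"
  let ?h = "\<lambda>\<beta>. F i \<beta> * mv_prod_list (map F is) (\<lambda>j. \<alpha> j - \<beta> j)"
  have IH: "mv_prod_list (map F is) (\<lambda>j. \<alpha> j - \<beta> j)
    = (if \<forall>j. j \<notin> set is \<longrightarrow> \<alpha> j - \<beta> j = 0 then \<Prod>i\<in>set is. g (\<alpha> i - \<beta> i) else 0)" for \<beta>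
    using Cons.prems by (intro Cons.IH) auto
  have "mv_prod_list (map F (i # is)) \<alpha> = (\<Sum>\<beta>\<in>?B. ?h \<beta>)"
    by (simp add: mv_prod_list_def mv_mult_def)
  also have "\<dots> = (\<Sum>\<beta>\<in>{?\<beta>}. ?h \<beta>)"
  proof (rule sum.mono_neutral_right)
    show "finite ?B" using Cons.prems(2) by (rule finite_monomials_below)
    show "{?\<beta>} \<subseteq> ?B" by auto
    show "\<forall>\<beta>\<in>?B - {?\<beta>}. ?h \<beta> = 0"
    proof (rule ballI, rule ccontr)
      fix \<beta> assume \<beta>: "\<beta> \<in> ?B - {?\<beta>}" and "?h \<beta> \<noteq> 0"
      then have "F i \<beta> \<noteq> 0" "mv_prod_list (map F is) (\<lambda>j. \<alpha> j - \<beta> j) \<noteq> 0" by auto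
      then have "\<forall>j. j \<noteq> i \<longrightarrow> \<beta> j = 0" "\<forall>j. j \<notin> set is \<longrightarrow> \<alpha> j - \<beta> j = 0"
        unfolding F IH by (auto split: if_splits)
      moreover have "i \<notin> set is" "\<beta> i \<le> \<alpha> i" using Cons.prems \<beta> by auto
      ultimately have "\<beta> = ?\<beta>" by (auto simp: fun_eq_iff)
      with \<beta> show False by simp
    qed
  qed
  also have "\<dots> = g (\<alpha> i) * (if \<forall>j. j \<notin> set is \<longrightarrow> \<alpha> j - ?\<beta> j = 0 then \<Prod>j\<in>set is. g (\<alpha> j - ?\<beta> j) else 0)"
    unfolding IH by (simp add: F)
  also have "(\<Prod>j\<in>set is. g (\<alpha> j - ?\<beta> j)) = (\<Prod>j\<in>set is. g (\<alpha> j))"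
    using Cons.prems(1) by (intro prod.cong) auto
  also have "(\<forall>j. j \<notin> set is \<longrightarrow> \<alpha> j - ?\<beta> j = 0) \<longleftrightarrow> (\<forall>j. j \<notin> set (i # is) \<longrightarrow> \<alpha> j = 0)"
    using Cons.prems(1) by auto
  finally have step: "mv_prod_list (map F (i # is)) \<alpha> = g (\<alpha> i)
      * (if \<forall>j. j \<notin> set (i # is) \<longrightarrow> \<alpha> j = 0 then \<Prod>j\<in>set is. g (\<alpha> j) else 0)" .
  have "(\<Prod>j\<in>set (i # is). g (\<alpha> j)) = g (\<alpha> i) * (\<Prod>j\<in>set is. g (\<alpha> j))"
    using Cons.prems(1) by simp
  then show ?case
    unfolding step by (simp only: if_distrib[of "(*) _"] mult_zero_right)
qed

text \<open>Since \<open>g 0 = 0\<close>, the product over \<open>S\<close> vanishes at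
  \<open>\<alpha>\<close> unless \<open>S\<close> is exactly the support of \<open>\<alpha>\<close>.
  This serves both the variables and the series \<open>Q\<close> minus 1.\<close>

lemma esym_univariate:
  assumes F: "\<And>i \<beta>. F i \<beta> = (if \<forall>j. j \<noteq> i \<longrightarrow> \<beta> j = 0 then g (\<beta> i) else 0)"
    and g: "g 0 = 0" and \<alpha>: "\<forall>i\<ge>N. \<alpha> i = 0"
  shows "esym (map F [0..<N]) k \<alpha>
    = (if card {i \<in> {..<N}. \<alpha> i \<noteq> 0} = k then \<Prod>i\<in>{i \<in> {..<N}. \<alpha> i \<noteq> 0}. g (\<alpha> i) else 0)"
proof -
  let ?I = "{i \<in> {..<N}. \<alpha> i \<noteq> 0}" and ?S = "{S. S \<subseteq> {..<N} \<and> card S = k}"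
  let ?h = "\<lambda>S. if \<forall>j. j \<notin> S \<longrightarrow> \<alpha> j = 0 then \<Prod>i\<in>S. g (\<alpha> i) else 0"
  have "esym (map F [0..<N]) k \<alpha> = (\<Sum>S\<in>?S. ?h S)"
    unfolding esym_def
  proof (rule sum.cong)
    fix S assume S: "S \<in> ?S"
    then have fin: "finite S" by (auto dest: finite_subset)
    have eq: "map ((!) (map F [0..<N])) (sorted_list_of_set S) = map F (sorted_list_of_set S)"
      using S fin by (intro map_cong) auto
    show "mv_prod_list (map ((!) (map F [0..<N])) (sorted_list_of_set S)) \<alpha> = ?h S"
      unfolding eq using mv_prod_list_univariate[OF F distinct_sorted_list_of_set \<alpha>, of S]
      by (simp only: set_sorted_list_of_set[OF fin])
  qed simp
  also have "\<dots> = (\<Sum>S\<in>?S \<inter> {?I}. ?h S)"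
  proof (rule sum.mono_neutral_right)
    show "\<forall>S\<in>?S - ?S \<inter> {?I}. ?h S = 0"
    proof (rule ballI, rule ccontr)
      fix S assume S: "S \<in> ?S - ?S \<inter> {?I}" "?h S \<noteq> 0"
      then have out: "\<forall>j. j \<notin> S \<longrightarrow> \<alpha> j = 0" and nz: "(\<Prod>i\<in>S. g (\<alpha> i)) \<noteq> 0"
        by (auto split: if_splits)
      have "finite S" using S by (auto dest: finite_subset)
      then have "\<forall>i\<in>S. \<alpha> i \<noteq> 0" using nz g by (metis prod_zero_iff)
      then have "S = ?I" using out S by auto
      with S show False by auto
    qed
  qed auto
  also have "\<dots> = (if card ?I = k then \<Prod>i\<in>?I. g (\<alpha> i) else 0)"
  proof -
    have "\<forall>j. j \<notin> ?I \<longrightarrow> \<alpha> j = 0" using \<alpha> by (auto simp: not_less)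
    then have hI: "?h ?I = (\<Prod>i\<in>?I. g (\<alpha> i))" by (rule if_P)
    show ?thesis
    proof (cases "card ?I = k")
      case True
      then have "?S \<inter> {?I} = {?I}" by auto
      with True hI show ?thesis by (simp only: sum.insert_if) simp
    next
      case False
      then have "?S \<inter> {?I} = {}" by auto
      with False show ?thesis by (simp only: sum.empty if_False)
    qed
  qed
  finally show ?thesis .
qed

lemma esym_xvars:
  assumes \<alpha>: "\<forall>i\<ge>N. \<alpha> i = 0"
  shows "esym (xvars N) k \<alpha> = of_bool (\<exists>S. S \<subseteq> {..<N} \<and> card S = k \<and> \<alpha> = (\<lambda>i. of_bool (i \<in> S)))"
proof -
  let ?I = "{i \<in> {..<N}. \<alpha> i \<noteq> 0}"
  have "esym (xvars N) k \<alpha> = (if card ?I = k then \<Prod>i\<in>?I. of_bool (\<alpha> i = 1) else 0)"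
    unfolding xvars_def using \<alpha>
    by (intro esym_univariate) (auto simp: mv_var_def fun_eq_iff)
  also have "(\<Prod>i\<in>?I. of_bool (\<alpha> i = 1)) = (of_bool (\<forall>i\<in>?I. \<alpha> i = 1) :: rat)"
    by (cases "\<forall>i\<in>?I. \<alpha> i = 1") auto
  also have "(if card ?I = k then of_bool (\<forall>i\<in>?I. \<alpha> i = 1) else 0)
     = (of_bool (card ?I = k \<and> (\<forall>i\<in>?I. \<alpha> i = 1)) :: rat)" by simp
  also have "(card ?I = k \<and> (\<forall>i\<in>?I. \<alpha> i = 1))
    \<longleftrightarrow> (\<exists>S. S \<subseteq> {..<N} \<and> card S = k \<and> \<alpha> = (\<lambda>i. of_bool (i \<in> S)))"
  proof
    assume *: "card ?I = k \<and> (\<forall>i\<in>?I. \<alpha> i = 1)"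
    have "\<alpha> i = of_bool (i \<in> ?I)" for i
      using * \<alpha> by (cases "i < N") (auto simp: not_less)
    then have "\<alpha> = (\<lambda>i. of_bool (i \<in> ?I))" by (rule ext)
    moreover have "?I \<subseteq> {..<N}" by blast
    ultimately show "\<exists>S. S \<subseteq> {..<N} \<and> card S = k \<and> \<alpha> = (\<lambda>i. of_bool (i \<in> S))"
      using * by blast
  next
    assume "\<exists>S. S \<subseteq> {..<N} \<and> card S = k \<and> \<alpha> = (\<lambda>i. of_bool (i \<in> S))"
    then obtain S where S: "S \<subseteq> {..<N}" "card S = k" "\<alpha> = (\<lambda>i. of_bool (i \<in> S))" by blast
    then have "?I = S" by auto
    with S show "card ?I = k \<and> (\<forall>i\<in>?I. \<alpha> i = 1)" by simp
  qed
  finally show ?thesis .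
qed

text \<open>In the convolution only the \<open>\<beta>\<close> that are indicators of
  \<open>k\<close>-subsets of the support of \<open>\<alpha>\<close> count. The recursion has the
  shape of \<open>card_margin_matrices_insert_row\<close>.\<close>

lemma elam_Cons:
  assumes \<alpha>: "\<forall>i\<ge>N. \<alpha> i = 0"
  shows "elam N (k # mu) \<alpha> = (\<Sum>S | S \<subseteq> {..<N} \<and> card S = k \<and> (\<forall>j\<in>S. 1 \<le> \<alpha> j).
      elam N mu (\<lambda>j. \<alpha> j - of_bool (j \<in> S)))"
proof -
  let ?B = "{\<beta>. \<forall>i. \<beta> i \<le> \<alpha> i}" and ?S = "{S. S \<subseteq> {..<N} \<and> card S = k \<and> (\<forall>j\<in>S. 1 \<le> \<alpha> j)}"
  let ?x = "\<lambda>S i. of_bool (i \<in> S) :: nat"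
  have esym: "esym (xvars N) k \<beta> = of_bool (\<beta> \<in> ?x ` ?S)" if "\<beta> \<in> ?B" for \<beta>
  proof -
    have \<beta>: "\<forall>i\<ge>N. \<beta> i = 0" using that \<alpha> by (metis (mono_tags) le_zero_eq mem_Collect_eq)
    have "(\<exists>S. S \<subseteq> {..<N} \<and> card S = k \<and> \<beta> = ?x S) \<longleftrightarrow> \<beta> \<in> ?x ` ?S"
    proof
      assume "\<exists>S. S \<subseteq> {..<N} \<and> card S = k \<and> \<beta> = ?x S"
      then obtain S where S: "S \<subseteq> {..<N}" "card S = k" "\<beta> = ?x S" by blast
      have "1 \<le> \<alpha> j" if "j \<in> S" for j
        using \<open>\<beta> \<in> ?B\<close> that unfolding S(3) by (auto dest: spec[of _ j])
      then show "\<beta> \<in> ?x ` ?S" using S by blast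
    qed auto
    then show ?thesis unfolding esym_xvars[OF \<beta>] by simp
  qed
  have "elam N (k # mu) \<alpha> = (\<Sum>\<beta>\<in>?B. esym (xvars N) k \<beta> * elam N mu (\<lambda>i. \<alpha> i - \<beta> i))"
    by (simp add: elam_def mv_prod_list_def mv_mult_def)
  also have "\<dots> = (\<Sum>\<beta>\<in>?B. of_bool (\<beta> \<in> ?x ` ?S) * elam N mu (\<lambda>i. \<alpha> i - \<beta> i))"
    by (intro sum.cong) (simp_all only: esym)
  also have "\<dots> = (\<Sum>\<beta>\<in>?x ` ?S. elam N mu (\<lambda>i. \<alpha> i - \<beta> i))"
  proof (rule sum.mono_neutral_cong_right)
    show "finite ?B" using \<alpha> by (rule finite_monomials_below)
    show "?x ` ?S \<subseteq> ?B" by (auto simp: of_bool_def)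
  qed auto
  also have "\<dots> = (\<Sum>S\<in>?S. elam N mu (\<lambda>j. \<alpha> j - of_bool (j \<in> S)))"
  proof (subst sum.reindex)
    show "inj_on ?x ?S" by (auto simp: inj_on_def fun_eq_iff of_bool_eq_iff)
  qed simp
  finally show ?thesis .
qed

text \<open>Each factor of the product chooses the set of columns of one row; both sides obey the
  same recursion in the first part.\<close>

lemma elam_eq_card_margin_matrices:
  assumes "\<forall>i\<ge>N. \<alpha> i = 0"
  shows "elam N mu \<alpha> = of_nat (card (margin_matrices {..<length mu} {..<N} ((!) mu) \<alpha>))"
  using assms
proof (induction mu arbitrary: \<alpha>)
  case Nil
  then have "(\<forall>j\<in>{..<N}. \<alpha> j = 0) \<longleftrightarrow> (\<forall>i. \<alpha> i = 0)" by (metis lessThan_iff not_le)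
  then show ?case by (simp add: elam_def mv_prod_list_def mv_one_def margin_matrices_empty)
next
  case (Cons k mu)
  have rows: "{..<length (k # mu)} = insert 0 (Suc ` {..<length mu})"
    by (simp add: lessThan_Suc_eq_insert_0)
  have shift: "card (margin_matrices (Suc ` {..<length mu}) {..<N} ((!) (k # mu)) \<beta>)
    = card (margin_matrices {..<length mu} {..<N} ((!) mu) \<beta>)" for \<beta>
    by (simp add: card_margin_matrices_image comp_def)
  have IH: "elam N mu (\<lambda>j. \<alpha> j - of_bool (j \<in> S))
    = of_nat (card (margin_matrices {..<length mu} {..<N} ((!) mu) (\<lambda>j. \<alpha> j - of_bool (j \<in> S))))" for S
    using Cons.prems by (intro Cons.IH) auto
  show ?case
    unfolding elam_Cons[OF Cons.prems] rows IH
    by (subst card_margin_matrices_insert_row) (simp_all add: shift)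
qed

text \<open>\<open>{..<N}\<close> has no subset with more than \<open>N\<close> elements, so the
  factor for \<open>x\<close> vanishes.\<close>

lemma elam_eq_0:
  assumes "\<forall>i\<ge>N. \<alpha> i = 0" "x \<in> set mu" "N < x"
  shows "elam N mu \<alpha> = 0"
  using assms(1,2)
proof (induction mu arbitrary: \<alpha>)
  case (Cons k mu)
  show ?case
  proof (cases "x = k")
    case True
    have "card S \<noteq> k" if "S \<subseteq> {..<N}" for S
      using card_mono[OF _ that] True assms(3) by auto
    then show ?thesis unfolding elam_Cons[OF Cons.prems(1)] by (intro sum.neutral) auto
  next
    case False
    then have "elam N mu (\<lambda>j. \<alpha> j - of_bool (j \<in> S)) = 0" for S
      using Cons.prems by (intro Cons.IH) auto
    then show ?thesis unfolding elam_Cons[OF Cons.prems(1)] by simp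
  qed
qed simp

text \<open>A variable with exponent 0 is a column with sum zero in the matrix count.\<close>

lemma elam_Suc_unused_variable:
  assumes "\<forall>i\<ge>N. \<alpha> i = 0"
  shows "elam (Suc N) mu \<alpha> = elam N mu \<alpha>"
proof -
  have "card (margin_matrices I {..<Suc N} \<mu> \<alpha>) = card (margin_matrices I {..<N} \<mu> \<alpha>)"
    if "finite I" for I :: "nat set" and \<mu>
    unfolding card_margin_matrices_transpose[of I] lessThan_Suc
    using that assms by (intro card_margin_matrices_zero_row) auto
  then show ?thesis using assms by (simp add: elam_eq_card_margin_matrices)
qed

text \<open>In \<open>N\<close> variables the factor for the part \<open>N\<close> is the product of
  all variables, so it only shifts each exponent by 1.\<close>

lemma elam_Cons_full:
  assumes \<alpha>: "\<forall>i\<ge>N. \<alpha> i = 0"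
  shows "elam N (N # mu) (\<lambda>i. if i < N then Suc (\<alpha> i) else 0) = elam N mu \<alpha>"
proof -
  let ?\<alpha> = "\<lambda>i. if i < N then Suc (\<alpha> i) else 0"
  have "{S. S \<subseteq> {..<N} \<and> card S = N \<and> (\<forall>j\<in>S. 1 \<le> ?\<alpha> j)} = {{..<N}}"
    using card_subset_eq[of "{..<N}"] by auto
  moreover have "(\<lambda>j. ?\<alpha> j - of_bool (j \<in> {..<N})) = \<alpha>" using \<alpha> by (auto simp: fun_eq_iff)
  moreover have "\<forall>i\<ge>N. ?\<alpha> i = 0" by simp
  ultimately show ?thesis by (simp only: elam_Cons) simp
qed

text \<open>Setting the last variable to 0 kills exactly the \<open>elam\<close> with a part equal to the number of
  variables; the remaining relation is divisible by the product of all variables.\<close>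
lemma elam_independent:
  assumes "\<And>\<alpha>. \<forall>i\<ge>N. \<alpha> i = 0 \<Longrightarrow> (\<Sum>i<N. \<alpha> i) = n \<Longrightarrow>
      (\<Sum>mu | is_partition mu \<and> sum_list mu = n. d mu * elam N mu \<alpha>) = 0"
    and "is_partition mu" "sum_list mu = n" "\<forall>x\<in>set mu. x \<le> N"
  shows "d mu = 0"
  using assms
proof (induction N arbitrary: d n mu)
  case 0
  have "x \<notin> set mu" for x
    using "0.prems"(2) "0.prems"(4) unfolding is_partition_def by (metis le_zero_eq less_irrefl)
  then have "mu = []" by (cases mu) auto
  moreover from this have "n = 0" using "0.prems"(3) by simp
  ultimately have mu: "mu = []" "n = 0" .
  have "nu = []" if "is_partition nu" "sum_list nu = 0" for nu
    using that by (cases nu) (auto simp: is_partition_def)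
  moreover have "is_partition []" by (simp add: is_partition_def)
  ultimately have "{mu. is_partition mu \<and> sum_list mu = 0} = {[]}" by auto
  then have "d [] * elam 0 [] (\<lambda>_. 0) = 0" using "0.prems"(1)[of "\<lambda>_. 0"] mu by simp
  then show ?case by (simp add: mu elam_def mv_prod_list_def mv_one_def)
next
  case (Suc N)
  note outer = Suc.IH
  show ?case
    using Suc.prems
  \<comment> \<open>The inner induction runs over the degree: dividing by the product of the
    variables keeps their number and lowers the degree by \<open>Suc N\<close>.\<close>
  proof (induction n arbitrary: d mu rule: less_induct)
    case (less n)
    have small: "d nu = 0" if "is_partition nu" "sum_list nu = n" "\<forall>x\<in>set nu. x \<le> N" for nu
    proof (rule outer[OF _ that])
      fix \<alpha> :: "nat \<Rightarrow> nat" assume \<alpha>: "\<forall>i\<ge>N. \<alpha> i = 0" "(\<Sum>i<N. \<alpha> i) = n"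
      then show "(\<Sum>mu | is_partition mu \<and> sum_list mu = n. d mu * elam N mu \<alpha>) = 0"
        using less.prems(1)[of \<alpha>] by (simp add: elam_Suc_unused_variable)
    qed
    show ?case
    proof (cases "\<forall>x\<in>set mu. x \<le> N")
      case True
      then show ?thesis using small less.prems by blast
    next
      case False
      then have "Suc N \<in> set mu" using less.prems(4) by (metis le_SucE)
      then obtain mu' where mu: "mu = Suc N # mu'"
        using less.prems(2,4) by (cases mu) (auto simp: is_partition_def intro: antisym)
      have mu': "is_partition mu'" "sum_list mu' = n - Suc N" "\<forall>x\<in>set mu'. x \<le> Suc N" "Suc N \<le> n"
        using less.prems mu by (auto simp: is_partition_def)
      \<comment> \<open>The coefficients of the divided relation. Prepending \<open>Suc N\<close>
        preserves partitions only if no part exceeds \<open>Suc N\<close>; elsewhere the value 0 is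
        chosen.\<close>
      define d' where "d' nu = (if \<forall>x\<in>set nu. x \<le> Suc N then d (Suc N # nu) else 0)" for nu
      have "d' mu' = 0"
      proof (rule less.IH[OF _ _ mu'(1-3)])
        show "n - Suc N < n" using mu'(4) by simp
        fix \<alpha> :: "nat \<Rightarrow> nat" assume \<alpha>: "\<forall>i\<ge>Suc N. \<alpha> i = 0" "(\<Sum>i<Suc N. \<alpha> i) = n - Suc N"
        let ?\<alpha> = "\<lambda>i. if i < Suc N then Suc (\<alpha> i) else 0"
        let ?P = "\<lambda>n. {mu. is_partition mu \<and> sum_list mu = n}"
        let ?Q = "{nu \<in> ?P (n - Suc N). \<forall>x\<in>set nu. x \<le> Suc N}"
        have \<alpha>': "\<forall>i\<ge>Suc N. ?\<alpha> i = 0" by simp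
        have "(\<Sum>i<Suc N. ?\<alpha> i) = (\<Sum>i<Suc N. \<alpha> i + 1)" by (intro sum.cong) auto
        also have "\<dots> = n" using \<alpha>(2) mu'(4) by (simp only: sum.distrib) simp
        finally have "0 = (\<Sum>nu\<in>?P n. d nu * elam (Suc N) nu ?\<alpha>)"
          using less.prems(1)[OF \<alpha>'] by simp
        also have "\<dots> = (\<Sum>nu\<in>(#) (Suc N) ` ?Q. d nu * elam (Suc N) nu ?\<alpha>)"
        proof (rule sum.mono_neutral_right)
          show "(#) (Suc N) ` ?Q \<subseteq> ?P n" using mu'(4) by (auto simp: is_partition_def)
          show "\<forall>nu\<in>?P n - (#) (Suc N) ` ?Q. d nu * elam (Suc N) nu ?\<alpha> = 0"
          proof
            \<comment> \<open>Outside the image the coefficient is 0 by \<open>small\<close>, or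
              some part exceeds the number of variables; a largest part equal to
              \<open>Suc N\<close> would put \<open>nu\<close> into the image.\<close>
            fix nu assume nu: "nu \<in> ?P n - (#) (Suc N) ` ?Q"
            consider "\<forall>x\<in>set nu. x \<le> N" | x where "x \<in> set nu" "Suc N < x"
              | "Suc N \<in> set nu" "\<forall>x\<in>set nu. x \<le> Suc N"
              by (metis le_SucE not_le)
            then show "d nu * elam (Suc N) nu ?\<alpha> = 0"
            proof cases
              case 1
              then show ?thesis using small nu by simp
            next
              case 2
              then show ?thesis using elam_eq_0[OF \<alpha>'] by simp
            next
              case 3
              then obtain nu' where nu': "nu = Suc N # nu'"
                using nu by (cases nu) (auto simp: is_partition_def intro: antisym)
              then have "nu' \<in> ?Q" using nu 3 by (auto simp: is_partition_def)
              then show ?thesis using nu nu' by blast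
            qed
          qed
        qed (rule finite_partitions)
        also have "\<dots> = (\<Sum>nu\<in>?Q. d (Suc N # nu) * elam (Suc N) nu \<alpha>)"
          by (subst sum.reindex) (simp_all add: elam_Cons_full[OF \<alpha>(1)])
        also have "\<dots> = (\<Sum>nu\<in>?P (n - Suc N). d' nu * elam (Suc N) nu \<alpha>)"
          by (rule sum.mono_neutral_cong_left) (auto simp: d'_def finite_partitions)
        finally show "(\<Sum>nu\<in>?P (n - Suc N). d' nu * elam (Suc N) nu \<alpha>) = 0" ..
      qed
      then show ?thesis using mu'(3) by (simp add: d'_def mu)
    qed
  qed
qed

subsection \<open>The coefficient formula\<close>

text \<open>The coefficients lie in \<open>rat fps\<close>, which is not a field; the inverse works
  because the constant coefficient is 1.\<close>

lemma inverse_mult_Qt: "inverse (Qt Q) * Qt Q = 1"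
proof -
  have "Qt Q * inverse (Qt Q) = 1"
    unfolding fps_inverse_def[of "Qt Q"] by (rule fps_right_inverse) (simp add: Qt_def)
  then show ?thesis by (simp only: mult.commute)
qed

text \<open>The derivative is the logarithmic derivative times the series; coefficients of degree
  \<open>k\<close> are compared. The index \<open>Suc i\<close> undoes the shift
  \<open>m - 1\<close> in \<open>resQ\<close>.\<close>

lemma newton_identity_Qt:
  "of_nat (Suc k) * fps_nth (Qt Q) (Suc k) = (\<Sum>i\<le>k. resQ Q (Suc i) * fps_nth (Qt Q) (k - i))"
proof -
  have "fps_deriv (Qt Q) = fps_deriv (Qt Q) * inverse (Qt Q) * Qt Q"
    by (simp add: mult.assoc inverse_mult_Qt)
  then have "fps_nth (fps_deriv (Qt Q)) k = fps_nth (fps_deriv (Qt Q) * inverse (Qt Q) * Qt Q) k"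
    by (rule arg_cong)
  then show ?thesis
    unfolding fps_mult_nth[of _ "Qt Q"] by (simp add: resQ_def atLeast0AtMost)
qed

text \<open>Every nonzero exponent contributes exactly one factor \<open>t\<close>, the inner
  \<open>fps_X\<close>, so the power of \<open>t\<close> records the size of the support, which is
  the \<open>k\<close> of \<open>esym\<close>.\<close>

lemma prod_Qt_nth:
  assumes "finite A"
  shows "(\<Prod>i\<in>A. fps_nth (Qt Q) (\<alpha> i))
    = fps_const (\<Prod>i\<in>{i \<in> A. \<alpha> i \<noteq> 0}. fps_nth Q (\<alpha> i)) * fps_X ^ card {i \<in> A. \<alpha> i \<noteq> 0}"
  using assms
proof (induction A rule: finite_induct)
  case (insert a A)
  have "{i \<in> insert a A. \<alpha> i \<noteq> 0} = (if \<alpha> a = 0 then {i \<in> A. \<alpha> i \<noteq> 0} else insert a {i \<in> A. \<alpha> i \<noteq> 0})"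
    by auto
  then show ?case
    using insert by (simp add: Qt_def ac_simps flip: fps_const_mult)
qed simp

lemma fact_fps_const: "(fact n :: rat fps) = fps_const (fact n)"
  by (metis fps_of_nat of_nat_fact)

lemma prod_fps_const: "(\<Prod>i\<in>A. fps_const (f i)) = fps_const (\<Prod>i\<in>A. f i :: 'a::comm_ring_1)"
  by (induction A rule: infinite_finite_induct) simp_all

text \<open>The Moebius sign and the power-sum sign of a block combine to the product of
  \<open>(-1) ^ Suc (lam ! j)\<close> over its elements \<open>j\<close>. Over all blocks this is
  the same for every \<open>P\<close>, so the sign leaves the sum.\<close>

lemma augmented_monomial_resQ:
  assumes "is_partition lam"
  shows "augmented_monomial (\<lambda>n. (-1) ^ (n - 1) * resQ Q n) {..<length lam} ((!) lam)
    = (-1) ^ (sum_list lam - length lam) * (\<Sum>P | partition_on {0..<length lam} P.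
        fps_const (\<Prod>B\<in>P. fact (card B - 1)) * (\<Prod>B\<in>P. resQ Q (\<Sum>j\<in>B. lam ! j)))"
proof -
  let ?I = "{..<length lam}" and ?s = "\<lambda>n. (-1 :: rat fps) ^ n"
  have pos: "0 < lam ! j" if "j < length lam" for j
    using assms that by (auto simp: is_partition_def)
  have parity: "?s (m - 1) * ?s (n - 1) = ?s (m + n)" if "0 < m" "0 < n" for m n
    using that by (cases m; cases n) (simp_all add: power_add)
  have total: "?s (sum_list lam - length lam) = (\<Prod>j\<in>?I. ?s (Suc (lam ! j)))"
  proof -
    have sum: "sum_list lam = (\<Sum>j\<in>?I. lam ! j)" by (simp add: sum_list_sum_nth lessThan_atLeast0)
    have "length lam \<le> sum_list lam" using assms by (rule length_le_sum_list_partition)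
    \<comment> \<open>The surplus \<open>2 * length lam\<close> is even and does not affect the
      sign.\<close>
    then have "(\<Sum>j\<in>?I. Suc (lam ! j)) = (sum_list lam - length lam) + 2 * length lam"
      unfolding sum by (simp only: Suc_eq_plus1 sum.distrib) simp
    then show ?thesis by (simp only: power_sum[symmetric] power_add power_mult) simp
  qed
  have "(\<Prod>B\<in>P. ?s (card B - 1) * fact (card B - 1) * (?s (sum ((!) lam) B - 1) * resQ Q (sum ((!) lam) B)))
      = ?s (sum_list lam - length lam)
        * (fps_const (\<Prod>B\<in>P. fact (card B - 1)) * (\<Prod>B\<in>P. resQ Q (sum ((!) lam) B)))"
    if P: "partition_on ?I P" for P
  proof -
    have block: "finite B" "B \<noteq> {}" "B \<subseteq> ?I" if "B \<in> P" for B
      using that P by (auto simp: partition_on_def intro: finite_subset[of _ ?I])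
    have sign: "?s (card B - 1) * ?s (sum ((!) lam) B - 1) = (\<Prod>j\<in>B. ?s (Suc (lam ! j)))"
      if B: "B \<in> P" for B
    proof -
      have "0 < card B" using block[OF B] by (simp add: card_gt_0_iff)
      moreover have "0 < sum ((!) lam) B"
      proof (rule sum_pos)
        show "0 < lam ! j" if "j \<in> B" for j using block(3)[OF B] that pos by blast
      qed (use block[OF B] in simp_all)
      ultimately have "?s (card B - 1) * ?s (sum ((!) lam) B - 1) = ?s (card B + sum ((!) lam) B)"
        by (rule parity)
      also have "card B + sum ((!) lam) B = (\<Sum>j\<in>B. Suc (lam ! j))"
        by (simp only: Suc_eq_plus1_left sum.distrib) simp
      finally show ?thesis by (simp only: power_sum)
    qed
    have "(\<Prod>B\<in>P. ?s (card B - 1) * fact (card B - 1) * (?s (sum ((!) lam) B - 1) * resQ Q (sum ((!) lam) B)))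
      = (\<Prod>B\<in>P. (\<Prod>j\<in>B. ?s (Suc (lam ! j))) * (fps_const (fact (card B - 1)) * resQ Q (sum ((!) lam) B)))"
      by (intro prod.cong refl) (simp only: sign[symmetric] fact_fps_const ac_simps)
    also have "\<dots> = (\<Prod>B\<in>P. \<Prod>j\<in>B. ?s (Suc (lam ! j)))
        * (fps_const (\<Prod>B\<in>P. fact (card B - 1)) * (\<Prod>B\<in>P. resQ Q (sum ((!) lam) B)))"
      by (simp only: prod.distrib prod_fps_const)
    also have "(\<Prod>B\<in>P. \<Prod>j\<in>B. ?s (Suc (lam ! j))) = (\<Prod>j\<in>\<Union>P. ?s (Suc (lam ! j)))"
      using P block by (subst prod.Union_disjoint) (auto simp: partition_on_def disjoint_def)
    also have "\<dots> = ?s (sum_list lam - length lam)"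
      unfolding total partition_onD1[OF P, symmetric] ..
    finally show ?thesis .
  qed
  then show ?thesis
    unfolding augmented_monomial_def sum_distrib_left lessThan_atLeast0
    by (intro sum.cong) auto
qed

text \<open>For the empty partition the right side would be 1 against a constant term 0 on the left,
  hence \<open>lam \<noteq> []\<close>. The expansion defining \<open>b\<close> is read
  coefficientwise in \<open>N\<close> variables, where only partitions of the degree of the monomial
  contribute.\<close>

theorem theorem4p2:
  fixes Q :: "rat fps" and b :: "nat \<Rightarrow> nat list \<Rightarrow> rat" and lam :: "nat list"
  assumes Q0: "fps_nth Q 0 = 1"
    and b_def: "\<And>N k \<alpha>. 1 \<le> k \<Longrightarrow> (\<forall>i\<ge>N. \<alpha> i = 0) \<Longrightarrow>
        esym (map (\<lambda>i. mv_minus (mv_univ Q i) mv_one) [0..<N]) k \<alpha>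
          = (\<Sum>mu | is_partition mu \<and> sum_list mu = (\<Sum>i<N. \<alpha> i). b k mu * elam N mu \<alpha>)"
    and lam: "is_partition lam" "lam \<noteq> []"
  shows "Abs_fps (\<lambda>k. if k = 0 then 0 else b k lam)
       = fps_const ((-1) ^ (sum_list lam - length lam)
                    / (\<Prod>i\<in>set lam. fact (count_list lam i)))
         * (\<Sum>P | partition_on {0..<length lam} P.
              fps_const (\<Prod>B\<in>P. fact (card B - 1))
              * (\<Prod>B\<in>P. resQ Q (\<Sum>j\<in>B. lam ! j)))"
proof -
  \<comment> \<open>The sign turns the recurrence \<open>newton_identity_Qt\<close>, which has none,
    into Newton's identities for power sums.\<close>
  define p where "p n = (-1) ^ (n - 1) * resQ Q n" for n
  define h where "h k = fps_const (1 / fact k :: rat)" for k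
  interpret newton_sequence p "fps_nth (Qt Q)" h
  proof
    show "fps_nth (Qt Q) 0 = 1" by (simp add: Qt_def)
    show "of_nat (Suc k) * fps_nth (Qt Q) (Suc k) = (\<Sum>i\<le>k. (-1) ^ i * p (Suc i) * fps_nth (Qt Q) (k - i))" for k
      unfolding newton_identity_Qt p_def
      by (intro sum.cong refl) (simp add: mult.assoc[symmetric] flip: power_mult_distrib)
    show "h 0 = 1" by (simp add: h_def)
    show "of_nat (Suc k) * h (Suc k) = h k" for k
    proof -
      have "of_nat (Suc k) * h (Suc k) = fps_const (of_nat (Suc k) * (1 / fact (Suc k)))"
        unfolding h_def fps_of_nat[symmetric] fps_const_mult ..
      also have "of_nat (Suc k) * (1 / fact (Suc k)) = (1 / fact k :: rat)"
        by (simp del: of_nat_Suc)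
      finally show ?thesis unfolding h_def .
    qed
  qed
  \<comment> \<open>\<open>?n\<close> serves as degree and as number of variables: no part of
    \<open>lam\<close> exceeds it, so \<open>elam_independent\<close> applies to
    \<open>lam\<close>.\<close>
  let ?n = "sum_list lam" and ?P = "{mu. is_partition mu \<and> sum_list mu = sum_list lam}"
  have parts: "\<forall>x\<in>set lam. x \<le> ?n" by (auto intro: member_le_sum_list)
  have "lam ! 0 \<in> set lam" using lam(2) by simp
  then have "0 < lam ! 0" "lam ! 0 \<le> ?n" using lam(1) parts by (simp_all add: is_partition_def)
  then have n: "0 < ?n" by linarith
  \<comment> \<open>Coefficients of \<open>t^k\<close> are compared in
    \<open>prod_E_eq_sum_partitions\<close>, whose left side is a single power of \<open>t\<close>
    with a rational factor by \<open>prod_Qt_nth\<close>.\<close>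
  have expansion: "(\<Sum>mu\<in>?P. fps_nth (monomial_value mu) k * elam ?n mu \<alpha>)
      = (if card {i \<in> {..<?n}. \<alpha> i \<noteq> 0} = k then \<Prod>i\<in>{i \<in> {..<?n}. \<alpha> i \<noteq> 0}. fps_nth Q (\<alpha> i) else 0)"
    if \<alpha>: "\<forall>i\<ge>?n. \<alpha> i = 0" "(\<Sum>i<?n. \<alpha> i) = ?n" for k \<alpha>
  proof -
    have "(\<Sum>mu\<in>?P. fps_nth (monomial_value mu) k * elam ?n mu \<alpha>) = fps_nth (\<Prod>i<?n. fps_nth (Qt Q) (\<alpha> i)) k"
      unfolding prod_E_eq_sum_partitions \<alpha>(2) fps_sum_nth
      by (intro sum.cong refl) (simp add: elam_eq_card_margin_matrices[OF \<alpha>(1)] flip: fps_of_nat)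
    then show ?thesis by (auto simp: prod_Qt_nth)
  qed
  have "b k lam = fps_nth (monomial_value lam) k" if k: "1 \<le> k" for k
  proof -
    have "b k lam - fps_nth (monomial_value lam) k = 0"
    proof (rule elam_independent[where N = ?n and n = ?n])
      fix \<alpha> :: "nat \<Rightarrow> nat" assume \<alpha>: "\<forall>i\<ge>?n. \<alpha> i = 0" "(\<Sum>i<?n. \<alpha> i) = ?n"
      have "(\<Sum>mu\<in>?P. b k mu * elam ?n mu \<alpha>)
        = esym (map (\<lambda>i. mv_minus (mv_univ Q i) mv_one) [0..<?n]) k \<alpha>"
        using b_def[OF k \<alpha>(1)] \<alpha>(2) by simp
      also have "\<dots> = (if card {i \<in> {..<?n}. \<alpha> i \<noteq> 0} = k
          then \<Prod>i\<in>{i \<in> {..<?n}. \<alpha> i \<noteq> 0}. fps_nth Q (\<alpha> i) - of_bool (\<alpha> i = 0) else 0)"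
      proof (rule esym_univariate[OF _ _ \<alpha>(1)])
        show "mv_minus (mv_univ Q i) mv_one \<beta>
          = (if \<forall>j. j \<noteq> i \<longrightarrow> \<beta> j = 0 then fps_nth Q (\<beta> i) - of_bool (\<beta> i = 0) else 0)" for i \<beta>
        proof -
          define Z where "Z \<longleftrightarrow> (\<forall>j. j \<noteq> i \<longrightarrow> \<beta> j = 0)"
          have one: "(\<forall>j. \<beta> j = 0) \<longleftrightarrow> Z \<and> \<beta> i = 0" unfolding Z_def by metis
          show ?thesis
            unfolding mv_minus_def mv_univ_def mv_one_def unfolding Z_def[symmetric] one by simp
        qed
      qed (simp add: Q0)
      \<comment> \<open>On the support of \<open>\<alpha>\<close> the correction
        \<open>of_bool (\<alpha> i = 0)\<close> is 0, so subtracting 1 from the series leaves the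
        factors unchanged.\<close>
      also have "\<dots> = (\<Sum>mu\<in>?P. fps_nth (monomial_value mu) k * elam ?n mu \<alpha>)"
        unfolding expansion[OF \<alpha>] by simp
      finally show "(\<Sum>mu\<in>?P. (b k mu - fps_nth (monomial_value mu) k) * elam ?n mu \<alpha>) = 0"
        by (simp add: left_diff_distrib sum_subtractf)
    qed (use lam parts in auto)
    then show ?thesis by simp
  qed
  \<comment> \<open>The degree is positive, so every exponent vector of that degree has nonempty
    support and nothing occurs at \<open>t^0\<close>. This matches the value 0 set at
    \<open>k = 0\<close>.\<close>
  moreover have "fps_nth (monomial_value lam) 0 = 0"
  proof (rule elam_independent[where N = ?n and n = ?n])
    fix \<alpha> :: "nat \<Rightarrow> nat" assume \<alpha>: "\<forall>i\<ge>?n. \<alpha> i = 0" "(\<Sum>i<?n. \<alpha> i) = ?n"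
    have "{i \<in> {..<?n}. \<alpha> i \<noteq> 0} \<noteq> {}"
    proof
      assume "{i \<in> {..<?n}. \<alpha> i \<noteq> 0} = {}"
      then have "(\<Sum>i<?n. \<alpha> i) = 0" by (intro sum.neutral) auto
      then show False using \<alpha>(2) n by linarith
    qed
    then show "(\<Sum>mu\<in>?P. fps_nth (monomial_value mu) 0 * elam ?n mu \<alpha>) = 0"
      unfolding expansion[OF \<alpha>] by (intro if_not_P) (simp add: card_eq_0_iff)
  qed (use lam parts in auto)
  ultimately have "Abs_fps (\<lambda>k. if k = 0 then 0 else b k lam) = monomial_value lam"
    by (intro fps_ext) (simp add: Suc_le_eq)
  also have "\<dots> = fps_const ((-1) ^ (sum_list lam - length lam)
                    / (\<Prod>i\<in>set lam. fact (count_list lam i)))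
         * (\<Sum>P | partition_on {0..<length lam} P.
              fps_const (\<Prod>B\<in>P. fact (card B - 1))
              * (\<Prod>B\<in>P. resQ Q (\<Sum>j\<in>B. lam ! j)))"
  proof -
    have p: "p = (\<lambda>n. (-1) ^ (n - 1) * resQ Q n)" by (simp add: p_def fun_eq_iff)
    let ?s = "(-1) ^ (sum_list lam - length lam)" and ?f = "\<Prod>i\<in>set lam. fact (count_list lam i)"
    have H: "(\<Prod>i\<in>set lam. h (count_list lam i)) = fps_const (1 / ?f)"
      unfolding h_def prod_fps_const by (simp add: prod_dividef)
    have "(-1) ^ m = fps_const ((-1) ^ m :: rat)" for m
      by (induction m) simp_all
    then have S: "fps_const (?s / ?f :: rat) = ?s * fps_const (1 / ?f)" by simp
    show ?thesis
      unfolding monomial_value_def unfolding p augmented_monomial_resQ[OF lam(1)] H S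
      by (simp only: ac_simps)
  qed
  finally show ?thesis .
qed

end
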